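(* For every integer $m$ and every positive integer $n$, the number $N_S(m,n)$ equals the number of doubly marked partitions of $n$ with spt-crank $m$.
   Context: Partitions are written with weakly decreasing parts $\lambda=(\lambda_1,\dots,\lambda_\ell)$; $\ell(\lambda)$ is the number of parts, $\lambda'$ the conjugate partition (so $\lambda'_s$ is the number of parts of $\lambda$ that are $\ge s$), and $D(\lambda)$ the side length of the Durfee square of $\lambda$. For a partition $\lambda$, $s(\lambda)$ denotes its smallest part, with $s(\emptyset)=+\infty$. $S$-partitions: let $\mathcal D$ be the set of partitions into distinct parts and $\mathcal P$ the set of all partitions. An $S$-partition is a triple $\pi=(\pi_1,\pi_2,\pi_3)\in\mathcal D\times\mathcal P\times\mathcal P$ with $\pi_1\neq\emptyset$ and $s(\pi_1)\le\min\{s(\pi_2),s(\pi_3)\}$. Its weight is $|\pi|=|\pi_1|+|\pi_2|+|\pi_3|$, its sign is $\omega(\pi)=(-1)^{\ell(\pi_1)-1}$, and its spt-crank is $r(\pi)=\ell(\pi_2)-\ell(\pi_3)$. Define $N_S(m,n)=\sum_{\pi}\omega(\pi)$, the sum over all $S$-partitions $\pi$ with $|\pi|=n$ and $r(\pi)=m$. Doubly marked partitions: a doubly marked partition of $n$ is a triple $(\lambda,s,t)$ where $\lambda$ is a partition of $n$ and $s,t$ are integers with $1\le s\le D(\lambda)$, $s\le t\le\lambda_1$, and $\lambda'_s=\lambda'_t$. Setting $g=\lambda'_s-s+1$ (which is $\ge 1$), the spt-crank of $(\lambda,s,t)$ is $c(\lambda,s,t)=g-\lambda_g+t-s$. *)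

theory Defs
  imports Complex_Main "HOL-Library.Extended_Nat"
begin

definition is_partition :: "nat list \<Rightarrow> bool" where
  "is_partition lam \<longleftrightarrow> sorted_wrt (\<ge>) lam \<and> 0 \<notin> set lam"

definition is_distinct_partition :: "nat list \<Rightarrow> bool" where
  "is_distinct_partition lam \<longleftrightarrow> is_partition lam \<and> distinct lam"

text \<open>Parts are indexed from 1; parts beyond the last one are 0.\<close>

definition part :: "nat list \<Rightarrow> nat \<Rightarrow> nat" where
  "part lam i = (if 1 \<le> i \<and> i \<le> length lam then lam ! (i - 1) else 0)"

definition conj_part :: "nat list \<Rightarrow> nat \<Rightarrow> nat" where
  "conj_part lam s = length (filter (\<lambda>p. s \<le> p) lam)"

definition young_diagram :: "nat list \<Rightarrow> (nat \<times> nat) set" where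
  "young_diagram lam = {(i, j). 1 \<le> i \<and> i \<le> length lam \<and> 1 \<le> j \<and> j \<le> part lam i}"

definition durfee :: "nat list \<Rightarrow> nat" where
  "durfee lam = Max {d. {1..d} \<times> {1..d} \<subseteq> young_diagram lam}"

text \<open>The infimum is taken in the extended naturals, so the empty partition has smallest
  part \<open>\<infinity>\<close>.\<close>

definition smallest_part :: "nat list \<Rightarrow> enat" where
  "smallest_part lam = (INF p\<in>set lam. enat p)"

type_synonym partition_triple = "nat list \<times> nat list \<times> nat list"

definition S_partitions :: "partition_triple set" where
  "S_partitions = {(p1, p2, p3).
     is_distinct_partition p1 \<and> is_partition p2 \<and> is_partition p3 \<and> p1 \<noteq> [] \<and>
     smallest_part p1 \<le> min (smallest_part p2) (smallest_part p3)}"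

fun S_weight :: "partition_triple \<Rightarrow> nat" where
  "S_weight (p1, p2, p3) = sum_list p1 + sum_list p2 + sum_list p3"

fun S_sign :: "partition_triple \<Rightarrow> int" where
  "S_sign (p1, p2, p3) = (- 1) ^ (length p1 - 1)"

fun S_crank :: "partition_triple \<Rightarrow> int" where
  "S_crank (p1, p2, p3) = int (length p2) - int (length p3)"

definition N_S :: "int \<Rightarrow> nat \<Rightarrow> int" where
  "N_S m n = (\<Sum>\<pi> \<in> {\<pi> \<in> S_partitions. S_weight \<pi> = n \<and> S_crank \<pi> = m}. S_sign \<pi>)"

definition doubly_marked_partitions :: "nat \<Rightarrow> (nat list \<times> nat \<times> nat) set" where
  "doubly_marked_partitions n = {(lam, s, t).
     is_partition lam \<and> sum_list lam = n \<and> 1 \<le> s \<and> s \<le> durfee lam \<and>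
     s \<le> t \<and> t \<le> part lam 1 \<and> conj_part lam s = conj_part lam t}"

text \<open>The subtraction of natural numbers in \<open>g\<close> does not truncate on doubly marked
  partitions, since \<open>s \<le> durfee lam\<close> forces \<open>s \<le> conj_part lam s\<close>.\<close>

fun dm_crank :: "nat list \<times> nat \<times> nat \<Rightarrow> int" where
  "dm_crank (lam, s, t) =
     (let g = conj_part lam s - s + 1
      in int g - int (part lam g) + int t - int s)"

text \<open>Finiteness of the sets being summed over and counted, without which \<open>sum\<close> and
  \<open>card\<close> would return the dummy value 0.\<close>

lemma is_partition_length_le:
  assumes "is_partition lam"
  shows "length lam \<le> sum_list lam"
proof -
  have "0 \<notin> set lam" using assms by (simp add: is_partition_def)
  then show ?thesis by (induction lam) auto
qed

lemma finite_partitions_le: "finite {lam. is_partition lam \<and> sum_list lam \<le> n}"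
proof (rule finite_subset)
  show "{lam. is_partition lam \<and> sum_list lam \<le> n} \<subseteq> {xs. set xs \<subseteq> {..n} \<and> length xs \<le> n}"
  proof clarify
    fix lam :: "nat list" assume lam: "is_partition lam" "sum_list lam \<le> n"
    have "x \<le> n" if "x \<in> set lam" for x
      using member_le_sum_list[OF that] lam(2) by linarith
    moreover have "length lam \<le> n"
      using is_partition_length_le[OF lam(1)] lam(2) by linarith
    ultimately show "set lam \<subseteq> {..n} \<and> length lam \<le> n" by auto
  qed
  show "finite {xs. set xs \<subseteq> {..n} \<and> length xs \<le> n}"
    by (rule finite_lists_length_le) simp
qed

lemma finite_S_partitions: "finite {\<pi> \<in> S_partitions. S_weight \<pi> = n \<and> S_crank \<pi> = m}"
proof (rule finite_subset)
  let ?P = "{lam. is_partition lam \<and> sum_list lam \<le> n}"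
  show "{\<pi> \<in> S_partitions. S_weight \<pi> = n \<and> S_crank \<pi> = m} \<subseteq> ?P \<times> ?P \<times> ?P"
    by (auto simp: S_partitions_def is_distinct_partition_def)
  show "finite (?P \<times> ?P \<times> ?P)"
    by (intro finite_cartesian_product finite_partitions_le)
qed

lemma finite_squares_in_diagram: "finite {d. {1..d} \<times> {1..d} \<subseteq> young_diagram lam}"
proof (rule finite_subset)
  show "{d. {1..d} \<times> {1..d} \<subseteq> young_diagram lam} \<subseteq> {..length lam}"
  proof
    fix d assume d: "d \<in> {d. {1..d} \<times> {1..d} \<subseteq> young_diagram lam}"
    show "d \<in> {..length lam}"
    proof (cases "d = 0")
      case False
      then have "(d, 1) \<in> {1..d} \<times> {1..d}" by simp
      with d have "(d, 1) \<in> young_diagram lam" by blast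
      then show ?thesis by (simp add: young_diagram_def)
    qed simp
  qed
qed simp

lemma finite_doubly_marked_partitions: "finite (doubly_marked_partitions n)"
proof (rule finite_subset)
  let ?P = "{lam. is_partition lam \<and> sum_list lam \<le> n}"
  have part1: "part lam 1 \<le> sum_list lam" for lam
    by (cases lam) (simp_all add: part_def)
  show "doubly_marked_partitions n \<subseteq> ?P \<times> {..n} \<times> {..n}"
  proof
    fix x assume x: "x \<in> doubly_marked_partitions n"
    obtain lam s t where [simp]: "x = (lam, s, t)" by (cases x)
    have "is_partition lam" "sum_list lam = n" "s \<le> t" "t \<le> part lam 1"
      using x by (simp_all add: doubly_marked_partitions_def)
    with part1[of lam] show "x \<in> ?P \<times> {..n} \<times> {..n}" by simp
  qed
  show "finite (?P \<times> {..n} \<times> {..n})"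
    by (intro finite_cartesian_product finite_partitions_le) simp_all
qed

end

theory Submission
  imports Defs "HOL-Computational_Algebra.Formal_Power_Series"
begin

text \<open>
  Stripping the smallest part \<open>k\<close> of \<open>\<pi>\<^sub>1\<close> from every part of \<open>\<pi>\<^sub>2\<close> and \<open>\<pi>\<^sub>3\<close>, and summing over \<open>k\<close> by a
  telescoping argument, turns the generating function of \<open>N\<^sub>S(m, n)\<close>, which is symmetric in \<open>m\<close>, into
  \<open>L\<^sub>m = \<Sum>\<^sub>c ((q)\<^sub>2\<^sub>c\<^sub>+\<^sub>m - (q)\<^sub>\<infinity>) / ((q)\<^sub>c (q)\<^sub>c\<^sub>+\<^sub>m)\<close> for \<open>m \<ge> 0\<close>. Cutting a doubly marked partition at row \<open>g\<close> and
  at row \<open>\<lambda>'\<^sub>s\<close> gives a positive sum \<open>D\<^sub>m\<close> over pairs \<open>g - l = m\<close>, where \<open>l = \<lambda>\<^sub>g - t + s\<close>.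
  Both sides vanish to order \<open>\<bar>m\<bar> + 1\<close>, so it suffices to compare first differences in \<open>m\<close>. Up to sign, each of these
  is the generating function of the partitions of rank at least \<open>k\<close> minus the one for crank at least \<open>k\<close>.
  Different series for the same count are identified because they satisfy Dyson's recursions
  \<open>R\<^sub>k = q\<^sup>k\<^sup>+\<^sup>1 (P - R\<^sub>k\<^sub>+\<^sub>3)\<close> and \<open>C\<^sub>k = q\<^sup>k (P - C\<^sub>k\<^sub>+\<^sub>1)\<close>, whose solutions are unique in the \<open>q\<close>-adic topology.
\<close>

text \<open>The two sides do not match term by term: one carries signs and an infinite product, the
  other a geometric series produced by the free choice of t. First differences in m repair both. On
  the S side the part with (q)_\<infinity> turns into a crank series and the part with (q)_(2c+m)
  into a rank series. On the marked side g is kept and l raised by one; the extra factor q^g cancels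
  one family of geometric series, leaving the crank part 1/((q)_(g-1) (q)_l) and a sum that a
  recursion in g identifies as an alternating rank part. The exponent g l is a rectangle, and the
  sum of q^(l(l+k)) / ((q)_l (q)_(l+k)) over l is P for every k. Hence the alternating part, summed
  along g - l = m, collapses to P times a partial theta series. The S side delivers the same counts
  in other shapes (Gaussian binomials, a product with (q)_\<infinity>), which is why the recursions
  are needed. The order of vanishing on the marked side comes from g l \<ge> |m| + 1 for g, l \<ge>
  1.\<close>

unbundle fps_syntax

abbreviation q :: "int fps" where "q \<equiv> fps_X"

lemma q_pow_nth: "(q ^ e * f) $ n = (if n < e then 0 else f $ (n - e))"
  by (simp add: fps_X_power_mult_nth)

section \<open>Sums of power series that converge q-adically\<close>

definition qsummable :: "(nat \<Rightarrow> int fps) \<Rightarrow> bool" where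
  "qsummable f \<longleftrightarrow> (\<forall>i n. n < i \<longrightarrow> f i $ n = 0)"

text \<open>The infinite sum of \<open>f\<close>. The truncation to \<open>i \<le> n\<close> only loses terms if \<open>f\<close> is not \<open>qsummable\<close>.\<close>

definition qsum :: "(nat \<Rightarrow> int fps) \<Rightarrow> int fps" where
  "qsum f = Abs_fps (\<lambda>n. \<Sum>i\<le>n. f i $ n)"

lemma qsum_nth: "qsum f $ n = (\<Sum>i\<le>n. f i $ n)"
  by (simp add: qsum_def)

lemma qsum_nth_le: "qsummable f \<Longrightarrow> n \<le> N \<Longrightarrow> qsum f $ n = (\<Sum>i\<le>N. f i $ n)"
  unfolding qsum_nth by (rule sum.mono_neutral_left) (auto simp: qsummable_def)

lemma qsummable_q_pow:
  assumes "\<And>i. i \<le> e i"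
  shows "qsummable (\<lambda>i. q ^ e i * f i)"
  unfolding qsummable_def q_pow_nth using assms less_le_trans by metis

lemma qsum_cong: "(\<And>i. f i = g i) \<Longrightarrow> qsum f = qsum g"
  by presburger

lemma qsum_add: "qsum (\<lambda>i. f i + g i) = qsum f + qsum g"
  by (rule fps_ext) (simp add: qsum_nth sum.distrib)

lemma qsum_diff: "qsum (\<lambda>i. f i - g i) = qsum f - qsum g"
  by (rule fps_ext) (simp add: qsum_nth sum_subtractf)

text \<open>A coefficient of the product involves several coefficients of the sum;
  \<open>qsummable f\<close> allows all of them to be cut at the common bound n.\<close>

lemma qsum_mult:
  assumes "qsummable f"
  shows "qsum (\<lambda>i. c * f i) = c * qsum f"
proof (rule fps_ext)
  fix n
  have "(c * qsum f) $ n = (\<Sum>j=0..n. c $ j * (\<Sum>i\<le>n. f i $ (n - j)))"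
    by (simp add: fps_mult_nth qsum_nth_le[OF assms, of _ n])
  also have "\<dots> = (\<Sum>i\<le>n. (c * f i) $ n)"
    by (simp add: fps_mult_nth sum_distrib_left) (rule sum.swap)
  finally show "qsum (\<lambda>i. c * f i) $ n = (c * qsum f) $ n" by (simp add: qsum_nth)
qed

lemma qsum_Suc:
  assumes "qsummable f"
  shows "qsum f = f 0 + qsum (\<lambda>i. f (Suc i))"
proof (rule fps_ext)
  fix n
  have "qsum f $ n = (\<Sum>i\<le>Suc n. f i $ n)" using assms by (rule qsum_nth_le) simp
  also have "\<dots> = f 0 $ n + (\<Sum>i\<le>n. f (Suc i) $ n)" by (rule sum.atMost_Suc_shift)
  finally show "qsum f $ n = (f 0 + qsum (\<lambda>i. f (Suc i))) $ n" by (simp add: qsum_nth)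
qed

text \<open>Coefficient n of the sum is cut after i = n and telescopes to \<open>a (Suc n)\<close>,
  hence the strict bound n < N.\<close>

lemma qsum_telescope:
  assumes "\<And>n N. n < N \<Longrightarrow> a N $ n = A $ n"
  shows "qsum (\<lambda>i. a (Suc i) - a i) = A - a 0"
proof (rule fps_ext)
  fix n
  have "(\<Sum>i\<le>N. a (Suc i) $ n - a i $ n) = a (Suc N) $ n - a 0 $ n" for N
    by (induction N) auto
  with assms[of n "Suc n"] show "qsum (\<lambda>i. a (Suc i) - a i) $ n = (A - a 0) $ n"
    by (simp add: qsum_nth)
qed

text \<open>Regrouping by x = i + b. Pairs with i + b > n contribute nothing to coefficient n, so
  the triangle and the full square agree.\<close>

lemma qsum_triangle:
  assumes "\<And>i j n. n < i + j \<Longrightarrow> t i j $ n = 0"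
  shows "qsum (\<lambda>x. \<Sum>b\<le>x. t (x - b) b) = qsum (\<lambda>b. qsum (\<lambda>i. t i b))"
proof (rule fps_ext)
  fix n
  have "qsum (\<lambda>x. \<Sum>b\<le>x. t (x - b) b) $ n = (\<Sum>(x, b)\<in>(SIGMA x:{..n}. {..x}). t (x - b) b $ n)"
    by (simp add: qsum_nth fps_sum_nth sum.Sigma)
  also have "\<dots> = (\<Sum>(b, i)\<in>{(b, i). i + b \<le> n}. t i b $ n)"
    by (rule sum.reindex_bij_witness[where i="\<lambda>(b, i). (i + b, b)" and j="\<lambda>(x, b). (b, x - b)"]) auto
  also have "\<dots> = (\<Sum>(b, i)\<in>{..n} \<times> {..n}. t i b $ n)"
    by (rule sum.mono_neutral_left) (use assms in \<open>auto simp: not_le[symmetric]\<close>)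
  finally show "qsum (\<lambda>x. \<Sum>b\<le>x. t (x - b) b) $ n = qsum (\<lambda>b. qsum (\<lambda>i. t i b)) $ n"
    by (simp add: qsum_nth sum.cartesian_product)
qed

section \<open>Finite q-products, their reciprocals and the partition series\<close>

definition geom_series :: "nat \<Rightarrow> int fps" where
  "geom_series h = Abs_fps (\<lambda>n. if h dvd n then 1 else 0)"

lemma geom_series_inv:
  assumes "h > 0"
  shows "(1 - q ^ h) * geom_series h = 1"
proof -
  have "geom_series h $ n = (1 + q ^ h * geom_series h) $ n" for n
  proof (cases "n < h")
    case True
    then have "h dvd n \<longleftrightarrow> n = 0" by (cases "n = 0") (simp_all add: nat_dvd_not_less)
    then show ?thesis using True by (simp add: q_pow_nth geom_series_def)
  next
    case False
    then have "h dvd n \<longleftrightarrow> h dvd n - h" by (metis dvd_minus_self linorder_not_less)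
    then show ?thesis using False assms by (auto simp: q_pow_nth geom_series_def)
  qed
  then have "geom_series h - q ^ h * geom_series h = 1" by (intro fps_ext) simp
  then show ?thesis by (simp add: left_diff_distrib)
qed

definition qpoch :: "nat \<Rightarrow> int fps" where
  "qpoch n = (\<Prod>i=1..n. 1 - q ^ i)"

text \<open>The inverse of \<open>qpoch n\<close>, written as a product because \<^typ>\<open>int fps\<close> has no inverse operation.\<close>

definition inv_qpoch :: "nat \<Rightarrow> int fps" where
  "inv_qpoch n = (\<Prod>i=1..n. geom_series i)"

lemma qpoch_0 [simp]: "qpoch 0 = 1" and qpoch_Suc: "qpoch (Suc n) = (1 - q ^ Suc n) * qpoch n"
  by (simp_all add: qpoch_def mult.commute)

lemma inv_qpoch_0 [simp]: "inv_qpoch 0 = 1" and inv_qpoch_Suc: "inv_qpoch (Suc n) = geom_series (Suc n) * inv_qpoch n"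
  by (simp_all add: inv_qpoch_def mult.commute)

lemma inv_qpoch_rec: "inv_qpoch n = (1 - q ^ Suc n) * inv_qpoch (Suc n)"
  by (metis geom_series_inv inv_qpoch_Suc mult.assoc mult_1 zero_less_Suc)

lemma qpoch_inv_qpoch: "qpoch n * inv_qpoch n = 1"
proof (induction n)
  case (Suc n)
  have "qpoch (Suc n) * inv_qpoch (Suc n) = (1 - q ^ Suc n) * geom_series (Suc n) * (qpoch n * inv_qpoch n)"
    by (simp only: qpoch_Suc inv_qpoch_Suc mult_ac)
  then show ?case using Suc by (simp only: geom_series_inv zero_less_Suc mult_1)
qed simp

text \<open>A further factor changes only coefficients beyond N. The coefficientwise limit is
  \<open>part_gf\<close>, the generating function of all partitions.\<close>

lemma inv_qpoch_stable: "n \<le> N \<Longrightarrow> inv_qpoch N $ n = inv_qpoch n $ n"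
proof (induction N rule: dec_induct)
  case (step N)
  have "inv_qpoch (Suc N) = inv_qpoch N + q ^ Suc N * inv_qpoch (Suc N)"
    using inv_qpoch_rec[of N] by (simp add: algebra_simps)
  then have "inv_qpoch (Suc N) $ n = inv_qpoch N $ n + (q ^ Suc N * inv_qpoch (Suc N)) $ n"
    by (metis fps_add_nth)
  then show ?case using step by (simp add: q_pow_nth del: power_Suc)
qed simp

definition part_gf :: "int fps" where "part_gf = Abs_fps (\<lambda>n. inv_qpoch n $ n)"

lemma inv_qpoch_part_gf: "n \<le> N \<Longrightarrow> inv_qpoch N $ n = part_gf $ n"
  unfolding part_gf_def fps_nth_Abs_fps by (rule inv_qpoch_stable)

lemma nth_mult_cong:
  assumes "\<And>i. i \<le> n \<Longrightarrow> f $ i = f' $ i" "\<And>i. i \<le> n \<Longrightarrow> g $ i = g' $ i"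
  shows "(f * g) $ n = (f' * g') $ (n::nat)"
  unfolding fps_mult_nth
proof (rule sum.cong[OF refl])
  fix i assume "i \<in> {0..n}"
  then have "f $ i = f' $ i" "g $ (n - i) = g' $ (n - i)" by (auto intro!: assms)
  then show "f $ i * g $ (n - i) = f' $ i * g' $ (n - i)" by (rule arg_cong2)
qed

text \<open>The difference of two solutions at k is -q^(e k) times their difference at k + a, so
  each use of the recursion lowers the coefficient index by e k > 0.\<close>

lemma q_recurrence_unique:
  fixes e :: "nat \<Rightarrow> nat"
  assumes "\<And>k. k > 0 \<Longrightarrow> f k = q ^ e k * (c - f (k + a))" "\<And>k. k > 0 \<Longrightarrow> g k = q ^ e k * (c - g (k + a))"
    and "\<And>k. k > 0 \<Longrightarrow> e k > 0" "k > 0"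
  shows "f k = (g k :: int fps)"
proof -
  have "\<forall>k>0. f k $ n = g k $ n" for n
  proof (induction n rule: less_induct)
    case (less n)
    show ?case
    proof (intro allI impI)
      fix k :: nat assume "k > 0"
      then have "e k > 0" by (rule assms(3))
      have "(q ^ e k * (c - f (k + a))) $ n = (q ^ e k * (c - g (k + a))) $ n"
      proof (cases "n < e k")
        case True
        then show ?thesis by (simp only: q_pow_nth if_True)
      next
        case False
        then have "f (k + a) $ (n - e k) = g (k + a) $ (n - e k)"
          using less[of "n - e k", rule_format, of "k + a"] \<open>k > 0\<close> \<open>e k > 0\<close> by linarith
        then show ?thesis by (simp only: q_pow_nth fps_sub_nth)
      qed
      then show "f k $ n = g k $ n"
        unfolding assms(1)[OF \<open>k > 0\<close>, symmetric] assms(2)[OF \<open>k > 0\<close>, symmetric] .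
    qed
  qed
  then have "f k $ n = g k $ n" for n using assms(4) by simp
  then show ?thesis by (rule fps_ext)
qed

text \<open>Combinatorially, each partition contains a unique largest l by l + k rectangle. The
  proof is algebraic: the sum does not depend on k, and for large k only l = 0 reaches a given
  coefficient.\<close>

lemma durfee_rectangle: "qsum (\<lambda>l. q ^ (l * (l + k)) * (inv_qpoch l * inv_qpoch (l + k))) = part_gf"
  (is "?F k = part_gf")
proof -
  have step: "?F (Suc k) - ?F k = 0" for k
  proof -
    \<comment> \<open>This is (1 - q^l) times the summand of \<open>?F k\<close>, written so that
      the value at l = 0 is visibly 0.\<close>
    define a where "a l = (case l of 0 \<Rightarrow> 0 | Suc l' \<Rightarrow> q ^ (l * (l + k)) * (inv_qpoch l' * inv_qpoch (l + k)))" for l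
    have "q ^ (l * (l + Suc k)) * (inv_qpoch l * inv_qpoch (l + Suc k)) - q ^ (l * (l + k)) * (inv_qpoch l * inv_qpoch (l + k))
       = a (Suc l) - a l" for l
    proof -
      have 1: "inv_qpoch (l + k) = (1 - q ^ Suc (l + k)) * inv_qpoch (Suc (l + k))"
        by (rule inv_qpoch_rec)
      have 2: "a l = q ^ (l * (l + k)) * ((1 - q ^ l) * inv_qpoch l * inv_qpoch (l + k))"
        using inv_qpoch_rec[of "l - 1"] by (cases l) (simp_all add: a_def)
      have 3: "a (Suc l) = q ^ (l * (l + k)) * q ^ l * q ^ Suc (l + k) * (inv_qpoch l * inv_qpoch (Suc (l + k)))"
        by (simp add: a_def power_add[symmetric] algebra_simps)
      have 4: "q ^ (l * (l + Suc k)) = q ^ (l * (l + k)) * q ^ l" by (simp add: power_add[symmetric] algebra_simps)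
      show ?thesis unfolding 2 3 4 unfolding add_Suc_right 1 by (simp add: algebra_simps del: power_Suc)
    qed
    then have "?F (Suc k) - ?F k = qsum (\<lambda>l. a (Suc l) - a l)"
      unfolding qsum_diff[symmetric] by presburger
    also have "\<dots> = 0 - a 0"
    proof (rule qsum_telescope)
      fix n N :: nat assume "n < N"
      then have "n < N * (N + k)" by (cases N) auto
      then show "a N $ n = 0 $ n" 
        by (cases N) (simp_all only: a_def q_pow_nth nat.case if_True fps_zero_nth)
    qed
    finally show ?thesis by (simp add: a_def)
  qed
  have const: "?F k = ?F (k + j)" for j
  proof (induction j)
    case (Suc j)
    then show ?case using step[of "k + j"] by simp
  qed simp
  show ?thesis
  proof (rule fps_ext)
    fix n
    \<comment> \<open>With k + n in place of k, every l \<ge> 1 has an exponent of at least 1 + k +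
      n.\<close>
    have "?F k $ n = (\<Sum>l\<le>n. (q ^ (l * (l + (k + n))) * (inv_qpoch l * inv_qpoch (l + (k + n)))) $ n)"
      unfolding const[of n] by (simp add: qsum_nth)
    also have "\<dots> = (\<Sum>l\<in>{0}. (q ^ (l * (l + (k + n))) * (inv_qpoch l * inv_qpoch (l + (k + n)))) $ n)"
    proof (rule sum.mono_neutral_right)
      show "\<forall>l\<in>{..n} - {0}. (q ^ (l * (l + (k + n))) * (inv_qpoch l * inv_qpoch (l + (k + n)))) $ n = 0"
      proof
        fix l assume "l \<in> {..n} - {0}"
        then have "1 * (1 + (k + n)) \<le> l * (l + (k + n))" by (intro mult_le_mono) auto
        then show "(q ^ (l * (l + (k + n))) * (inv_qpoch l * inv_qpoch (l + (k + n)))) $ n = 0"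
          by (simp add: q_pow_nth)
      qed
    qed auto
    finally show "?F k $ n = part_gf $ n" by (simp add: inv_qpoch_part_gf)
  qed
qed

lemma q_pow_split: "n = a + b \<Longrightarrow> q ^ n = q ^ a * q ^ b"
  by (simp add: power_add)

lemma diff_eq_swap: "a - b = c \<Longrightarrow> b = a - (c :: 'a :: ab_group_add)"
  by auto

lemma q_pow_cancel:
  assumes "n > 0" "(1 - q ^ n) * f = (1 - q ^ n) * g"
  shows "f = g"
proof -
  have "geom_series n * ((1 - q ^ n) * f) = geom_series n * ((1 - q ^ n) * g)" using assms(2) by simp
  moreover have "geom_series n * (1 - q ^ n) = 1" using geom_series_inv[OF assms(1)] by (simp add: mult.commute)
  ultimately show ?thesis unfolding mult.assoc[symmetric] by simp
qed

subsection \<open>The Euler function\<close>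

definition euler :: "int fps" where "euler = Abs_fps (\<lambda>n. qpoch n $ n)"

lemma qpoch_euler: "n \<le> N \<Longrightarrow> qpoch N $ n = euler $ n"
proof (induction N rule: dec_induct)
  case (step N)
  have "qpoch (Suc N) = qpoch N - q ^ Suc N * qpoch N"
    unfolding qpoch_Suc left_diff_distrib by simp
  then have "qpoch (Suc N) $ n = qpoch N $ n - (q ^ Suc N * qpoch N) $ n"
    by (simp only: fps_sub_nth)
  then show ?case using step by (simp add: q_pow_nth del: power_Suc)
qed (simp add: euler_def)

text \<open>\<open>euler\<close> is \<open>(q)\<^sub>\<infinity>\<close>, so \<open>euler_tail k\<close> is the product of \<open>1 - q\<^sup>i\<close> over all \<open>i > k\<close>.\<close>

definition euler_tail :: "nat \<Rightarrow> int fps" where "euler_tail k = euler * inv_qpoch k"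

lemma euler_tail_0 [simp]: "euler_tail 0 = euler"
  by (simp add: euler_tail_def)

lemma euler_tail_rec: "euler_tail k = (1 - q ^ Suc k) * euler_tail (Suc k)"
  unfolding euler_tail_def by (subst inv_qpoch_rec) (simp only: mult_ac)

lemma euler_tail_limit: "n \<le> k \<Longrightarrow> euler_tail k $ n = 1 $ n"
proof -
  assume "n \<le> k"
  then have "euler_tail k $ n = (qpoch k * inv_qpoch k) $ n"
    unfolding euler_tail_def by (intro nth_mult_cong) (simp_all add: qpoch_euler)
  then show ?thesis by (simp add: qpoch_inv_qpoch)
qed

lemma euler_part_gf: "euler * part_gf = 1"
proof (rule fps_ext)
  fix n
  have "(euler * part_gf) $ n = (qpoch n * inv_qpoch n) $ n"
    by (intro nth_mult_cong) (simp_all add: qpoch_euler inv_qpoch_part_gf)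
  then show "(euler * part_gf) $ n = 1 $ n" by (simp only: qpoch_inv_qpoch)
qed

text \<open>Term i belongs to distinct parts with smallest part i + 1, together with a further
  copies of that part. In the induction, consecutive sums differ by q^(a+1) times the sum with its
  index lowered by one, because of \<open>euler_tail_rec\<close>.\<close>

lemma qsum_euler_tail: "qsum (\<lambda>i. q ^ (Suc i * Suc a) * euler_tail (Suc i)) = qpoch a - euler"
proof (induction a)
  case 0
  have "q ^ (Suc i * Suc 0) * euler_tail (Suc i) = euler_tail (Suc i) - euler_tail i" for i
    unfolding euler_tail_rec[of i] by (simp add: left_diff_distrib)
  then have "qsum (\<lambda>i. q ^ (Suc i * Suc 0) * euler_tail (Suc i)) = qsum (\<lambda>i. euler_tail (Suc i) - euler_tail i)"
    by presburger
  also have "\<dots> = 1 - euler_tail 0"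
    by (rule qsum_telescope) (simp add: euler_tail_limit)
  finally show ?case by simp
next
  case (Suc a)
  let ?F = "\<lambda>a. qsum (\<lambda>i. q ^ (Suc i * Suc a) * euler_tail (Suc i))"
  let ?G = "qsum (\<lambda>i. q ^ (i * Suc a) * euler_tail i)"
  have "q ^ (Suc i * Suc a) * euler_tail (Suc i) - q ^ (Suc i * Suc (Suc a)) * euler_tail (Suc i)
      = q ^ Suc a * (q ^ (i * Suc a) * euler_tail i)" for i
  proof -
    have 1: "q ^ (Suc i * Suc a) = q ^ Suc a * q ^ (i * Suc a)"
      by (rule q_pow_split) simp
    have 2: "q ^ (Suc i * Suc (Suc a)) = q ^ Suc a * q ^ (i * Suc a) * q ^ Suc i"
      unfolding power_add[symmetric] by (rule arg_cong[of _ _ "(^) q"]) (simp add: algebra_simps)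
    show ?thesis unfolding 1 2 euler_tail_rec[of i] by (simp add: algebra_simps del: power_Suc)
  qed
  then have "?F a - ?F (Suc a) = qsum (\<lambda>i. q ^ Suc a * (q ^ (i * Suc a) * euler_tail i))"
    unfolding qsum_diff[symmetric] by presburger
  also have "\<dots> = q ^ Suc a * ?G"
    by (intro qsum_mult qsummable_q_pow) simp
  also have "?G = euler_tail 0 + ?F a"
    by (subst qsum_Suc) (auto intro!: qsummable_q_pow)
  finally have "?F (Suc a) = ?F a - q ^ Suc a * (euler + ?F a)"
    unfolding euler_tail_0 by (rule diff_eq_swap)
  then show ?case unfolding Suc.IH qpoch_Suc by (simp add: algebra_simps)
qed

subsection \<open>The crank series\<close>

text \<open>The shape produced by the S-partitions; \<open>crank_durfee\<close> is the one produced
  by the doubly marked partitions.\<close>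

definition crank_gf :: "nat \<Rightarrow> int fps" where
  "crank_gf k = euler * qsum (\<lambda>n. q ^ (n + k) * (inv_qpoch n * inv_qpoch (n + k)))"

definition crank_durfee :: "nat \<Rightarrow> int fps" where
  "crank_durfee k = qsum (\<lambda>n. q ^ (Suc n * (n + k)) * (inv_qpoch n * inv_qpoch (n + k)))"

text \<open>The summands for k and q^k times those for k + 1 add up to a telescoping difference with
  limit q^k times the square of \<open>part_gf\<close>; the factor \<open>euler\<close> cancels one
  copy.\<close>

lemma crank_gf_rec: "crank_gf k = q ^ k * (part_gf - crank_gf (Suc k))"
proof -
  let ?s = "\<lambda>k n. q ^ (n + k) * (inv_qpoch n * inv_qpoch (n + k))"
  \<comment> \<open>For every n this is (1 - q^n) / ((q)_n (q)_(n+k)).\<close>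
  define a where "a n = (case n of 0 \<Rightarrow> 0 | Suc m \<Rightarrow> inv_qpoch m * inv_qpoch (n + k))" for n
  have "?s k n + q ^ k * ?s (Suc k) n = q ^ k * (a (Suc n) - a n)" for n
  proof -
    have 1: "inv_qpoch (n + k) = (1 - q ^ Suc (n + k)) * inv_qpoch (Suc (n + k))" by (rule inv_qpoch_rec)
    have 2: "a n = (1 - q ^ n) * inv_qpoch n * inv_qpoch (n + k)"
      using inv_qpoch_rec[of "n - 1"] by (cases n) (simp_all add: a_def)
    have 3: "a (Suc n) = inv_qpoch n * inv_qpoch (Suc (n + k))" by (simp add: a_def)
    have 4: "q ^ (n + k) = q ^ n * q ^ k" "q ^ Suc (n + k) = q * q ^ n * q ^ k" by (simp_all add: power_add)
    show ?thesis unfolding 2 3 unfolding 1 add_Suc_right 4 by (simp add: algebra_simps)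
  qed
  then have *: "qsum (\<lambda>n. ?s k n + q ^ k * ?s (Suc k) n) = qsum (\<lambda>n. q ^ k * a (Suc n) - q ^ k * a n)"
    by (simp add: right_diff_distrib)
  have "qsum (\<lambda>n. q ^ k * a (Suc n) - q ^ k * a n) = q ^ k * (part_gf * part_gf) - q ^ k * a 0"
  proof (rule qsum_telescope)
    fix n N :: nat assume "n < N"
    have "a N $ i = (part_gf * part_gf) $ i" if "i \<le> n" for i
      using \<open>n < N\<close> that by (cases N) (auto simp: a_def inv_qpoch_part_gf intro!: nth_mult_cong)
    then show "(q ^ k * a N) $ n = (q ^ k * (part_gf * part_gf)) $ n" by (intro nth_mult_cong) auto
  qed
  then have "qsum (?s k) + q ^ k * qsum (?s (Suc k)) = q ^ k * (part_gf * part_gf)"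
    using * by (simp add: qsum_add qsum_mult[OF qsummable_q_pow] a_def del: power_Suc add_Suc_right)
  then have "euler * (qsum (?s k) + q ^ k * qsum (?s (Suc k))) = q ^ k * part_gf * (euler * part_gf)"
    by (simp add: mult_ac)
  then have "crank_gf k + q ^ k * crank_gf (Suc k) = q ^ k * part_gf"
    unfolding crank_gf_def euler_part_gf by (simp add: algebra_simps)
  then show ?thesis by (simp add: algebra_simps)
qed

text \<open>Rewriting \<open>inv_qpoch (n + k)\<close> over \<open>inv_qpoch (n + Suc k)\<close>
  frees the factor 1 - q^(n+k+1). It splits each term into a Durfee rectangle term of offset k + 1
  and a term of \<open>crank_durfee (Suc k)\<close>.\<close>

lemma crank_durfee_rec: "crank_durfee k = q ^ k * (part_gf - crank_durfee (Suc k))"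
proof -
  have "q ^ (Suc n * (n + k)) * (inv_qpoch n * inv_qpoch (n + k))
      = q ^ k * (q ^ (n * (n + Suc k)) * (inv_qpoch n * inv_qpoch (n + Suc k))
         - q ^ (Suc n * (n + Suc k)) * (inv_qpoch n * inv_qpoch (n + Suc k)))" for n
  proof -
    have 1: "inv_qpoch (n + k) = (1 - q ^ Suc (n + k)) * inv_qpoch (Suc (n + k))" by (rule inv_qpoch_rec)
    have 2: "q ^ (Suc n * (n + k)) = q ^ k * q ^ (n * (n + Suc k))"
      "q ^ (Suc n * (n + Suc k)) = q ^ (n * (n + Suc k)) * q ^ Suc (n + k)"
      by (rule q_pow_split; simp add: algebra_simps)+
    show ?thesis unfolding 2 unfolding 1 add_Suc_right by (simp add: algebra_simps del: power_Suc)
  qed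
  then have "crank_durfee k = qsum (\<lambda>n. q ^ k * (q ^ (n * (n + Suc k)) * (inv_qpoch n * inv_qpoch (n + Suc k))
         - q ^ (Suc n * (n + Suc k)) * (inv_qpoch n * inv_qpoch (n + Suc k))))"
    unfolding crank_durfee_def by presburger
  also have "\<dots> = q ^ k * (part_gf - crank_durfee (Suc k))"
  proof -
    have 1: "qsummable (\<lambda>n. q ^ (n * (n + Suc k)) * (inv_qpoch n * inv_qpoch (n + Suc k)))" 
      "qsummable (\<lambda>n. q ^ (Suc n * (n + Suc k)) * (inv_qpoch n * inv_qpoch (n + Suc k)))"
      by (rule qsummable_q_pow, simp)+
    show ?thesis
      unfolding right_diff_distrib qsum_diff qsum_mult[OF 1(1)] qsum_mult[OF 1(2)] durfee_rectangle crank_durfee_def ..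
  qed
  finally show ?thesis .
qed

lemma crank_gf_eq_crank_durfee: "k > 0 \<Longrightarrow> crank_gf k = crank_durfee k"
  by (rule q_recurrence_unique[where e="\<lambda>k. k" and a=1 and c=part_gf])
    (simp_all add: crank_gf_rec[symmetric] crank_durfee_rec[symmetric])

subsection \<open>The rank series\<close>

text \<open>The partitions of rank at least \<open>k > 0\<close>, with \<open>n + 1 + k\<close> the largest part and at most \<open>n + 1\<close> parts.\<close>

definition rank_gf :: "nat \<Rightarrow> int fps" where
  "rank_gf k = qsum (\<lambda>n. q ^ (n + Suc k) * (qpoch (2 * n + Suc k) * (inv_qpoch n * inv_qpoch (n + Suc k))))"

definition triangular :: "nat \<Rightarrow> nat" where "triangular n = \<Sum>{..n}"

lemma triangular_0 [simp]: "triangular 0 = 0" and triangular_Suc: "triangular (Suc n) = triangular n + Suc n"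
  by (simp_all add: triangular_def)

text \<open>With j = b + 1 the exponent is j(3j - 1)/2 + k j, as in the classical formula for the
  rank.\<close>

definition rank_theta :: "nat \<Rightarrow> int fps" where
  "rank_theta k = part_gf * qsum (\<lambda>b. q ^ (triangular (Suc b) + Suc b * (b + k)) * (-1) ^ b)"

lemma qsummable_rank_theta: "qsummable (\<lambda>b. q ^ (triangular (Suc b) + Suc b * (b + k)) * (-1) ^ b)"
  by (rule qsummable_q_pow) (simp add: triangular_Suc)

text \<open>Replacing j by j + 1 turns j(3j - 1)/2 + k j into j(3j - 1)/2 + (k + 3) j + k + 1; this
  is the origin of the shift by 3.\<close>

lemma rank_theta_rec: "rank_theta k = q ^ Suc k * (part_gf - rank_theta (k + 3))"
proof -
  let ?t = "\<lambda>k b. q ^ (triangular (Suc b) + Suc b * (b + k)) * (-1) ^ b :: int fps"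
  have "?t k (Suc b) = - (q ^ Suc k) * ?t (k + 3) b" for b
  proof -
    have "q ^ (triangular (Suc (Suc b)) + Suc (Suc b) * (Suc b + k)) = q ^ Suc k * q ^ (triangular (Suc b) + Suc b * (b + (k + 3)))"
      by (rule q_pow_split) (simp add: triangular_Suc algebra_simps)
    then show ?thesis by simp
  qed
  then have "qsum (\<lambda>b. ?t k (Suc b)) = qsum (\<lambda>b. - (q ^ Suc k) * ?t (k + 3) b)" by presburger
  also have "\<dots> = - (q ^ Suc k) * qsum (?t (k + 3))" by (rule qsum_mult[OF qsummable_rank_theta])
  finally have "qsum (?t k) = q ^ Suc k - q ^ Suc k * qsum (?t (k + 3))"
    by (subst qsum_Suc[OF qsummable_rank_theta]) (simp add: triangular_Suc)
  then have "part_gf * qsum (?t k) = part_gf * (q ^ Suc k - q ^ Suc k * qsum (?t (k + 3)))" by (rule arg_cong)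
  also have "\<dots> = q ^ Suc k * (part_gf - part_gf * qsum (?t (k + 3)))"
    by (simp only: right_diff_distrib mult_ac)
  finally show ?thesis unfolding rank_theta_def .
qed

lemma rank_gf_rec: "rank_gf k = q ^ Suc k * (part_gf - rank_gf (k + 3))"
proof -
  let ?s = "\<lambda>n. q ^ n * (qpoch (2 * n + Suc k) * (inv_qpoch n * inv_qpoch (n + Suc k)))"
  let ?r = "\<lambda>n. q ^ (n + Suc (k + 3)) * (qpoch (2 * n + Suc (k + 3)) * (inv_qpoch n * inv_qpoch (n + Suc (k + 3))))"
  \<comment> \<open>The terms of \<open>rank_gf (k + 3)\<close> are delayed by one index so that
    they pair with those of \<open>?s\<close>.\<close>
  define r where "r n = (case n of 0 \<Rightarrow> 0 | Suc m \<Rightarrow> ?r m)" for n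
  \<comment> \<open>At Suc m this is the Gaussian binomial of 2m + k + 3 over m; it tends to
    \<open>euler\<close> times the square of \<open>part_gf\<close>, which is
    \<open>part_gf\<close>.\<close>
  define a where "a n = (case n of 0 \<Rightarrow> 0 | Suc m \<Rightarrow> qpoch (2 * m + k + 3) * (inv_qpoch m * inv_qpoch (m + k + 3)))" for n
  have qsummable: "qsummable r"
    unfolding qsummable_def by (auto simp: r_def q_pow_nth simp del: power_Suc split: nat.split)
  have step: "?s n + r n = a (Suc n) - a n" for n
  proof (cases n)
    case 0
    have "qpoch (2 * 0 + Suc k) * inv_qpoch (0 + Suc k) = 1" "qpoch (2 * 0 + k + 3) * inv_qpoch (0 + k + 3) = 1"
      by (simp_all add: qpoch_inv_qpoch)
    then show ?thesis unfolding 0 by (simp add: r_def a_def)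
  next
    case (Suc m)
    let ?j = "2 * m + k + 3" and ?i = "m + k + 2"
    have 1: "qpoch (Suc ?j) = (1 - q ^ Suc ?j) * qpoch ?j"
      "qpoch (Suc (Suc ?j)) = (1 - q ^ Suc (Suc ?j)) * ((1 - q ^ Suc ?j) * qpoch ?j)"
      by (simp_all only: qpoch_Suc)
    have 2: "inv_qpoch m = (1 - q ^ Suc m) * inv_qpoch (Suc m)" "inv_qpoch (Suc ?i) = (1 - q ^ Suc (Suc ?i)) * inv_qpoch (Suc (Suc ?i))"
      "inv_qpoch ?i = (1 - q ^ Suc ?i) * ((1 - q ^ Suc (Suc ?i)) * inv_qpoch (Suc (Suc ?i)))"
      by (rule inv_qpoch_rec, rule inv_qpoch_rec, rule trans[OF inv_qpoch_rec[of ?i]], subst inv_qpoch_rec[of "Suc ?i"], rule refl)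
    \<comment> \<open>In terms of x and y the claim becomes a polynomial identity.\<close>
    define x y where "x = q ^ Suc m" and "y = q ^ Suc ?i"
    have 3: "q ^ Suc (Suc ?i) = q * y" "q ^ Suc ?j = x * y" "q ^ Suc (Suc ?j) = x * (q * y)"
      unfolding x_def y_def power_Suc[symmetric] power_add[symmetric]
      by (rule arg_cong[of _ _ "(^) q"]; simp)+
    have s: "?s n = x * (qpoch ?j * (inv_qpoch (Suc m) * inv_qpoch ?i))"
      unfolding Suc x_def by (simp add: numeral_eq_Suc)
    have r: "r n = (q * y) * (qpoch (Suc ?j) * (inv_qpoch m * inv_qpoch (Suc (Suc ?i))))"
      unfolding Suc y_def r_def by (simp add: numeral_eq_Suc)
    have a: "a (Suc n) = qpoch (Suc (Suc ?j)) * (inv_qpoch (Suc m) * inv_qpoch (Suc (Suc ?i)))"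
      "a n = qpoch ?j * (inv_qpoch m * inv_qpoch (Suc ?i))"
      unfolding Suc a_def by (simp_all add: numeral_eq_Suc)
    show ?thesis unfolding s r a unfolding 1 unfolding 2 unfolding x_def[symmetric] y_def[symmetric] 3
      by (simp add: algebra_simps)
  qed
  have "qsum (\<lambda>n. ?s n + r n) = part_gf - a 0"
    unfolding step
  proof (rule qsum_telescope)
    fix n N :: nat assume "n < N"
    then obtain m where m: "N = Suc m" "n \<le> m" by (cases N) auto
    have "a N $ n = (qpoch (2 * m + k + 3) * (inv_qpoch m * inv_qpoch (m + k + 3))) $ n" by (simp add: a_def m)
    also have "\<dots> = (euler * (part_gf * part_gf)) $ n"
      using m(2) by (intro nth_mult_cong) (auto simp: qpoch_euler inv_qpoch_part_gf)
    finally show "a N $ n = part_gf $ n" using euler_part_gf by (simp add: mult.assoc[symmetric])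
  qed
  moreover have "qsum r = rank_gf (k + 3)"
    unfolding rank_gf_def by (subst qsum_Suc[OF qsummable]) (simp add: r_def)
  ultimately have "qsum ?s = part_gf - rank_gf (k + 3)"
    by (simp add: qsum_add a_def algebra_simps)
  moreover have "rank_gf k = qsum (\<lambda>n. q ^ Suc k * ?s n)"
    unfolding rank_gf_def by (rule qsum_cong) (simp add: power_add mult_ac)
  ultimately show ?thesis
    by (simp add: qsum_mult qsummable_q_pow del: power_Suc)
qed

lemma rank_gf_eq_rank_theta: "k > 0 \<Longrightarrow> rank_gf k = rank_theta k"
  by (rule q_recurrence_unique[where e=Suc and a=3 and c=part_gf])
    (simp_all only: rank_gf_rec[symmetric] rank_theta_rec[symmetric])

text \<open>For fixed b the sum over i = x - b is a Durfee rectangle sum of offset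
  \<open>e b\<close>, hence \<open>part_gf\<close> for any choice of e. The two signs of m use
  different offsets.\<close>

lemma qsum_rank_theta:
  "qsum (\<lambda>x. \<Sum>b\<le>x. q ^ (triangular (Suc b) + Suc b * (b + k)) * (-1) ^ b *
      (q ^ ((x - b) * ((x - b) + e b)) * (inv_qpoch (x - b) * inv_qpoch ((x - b) + e b)))) = rank_theta k"
proof -
  let ?c = "\<lambda>b. q ^ (triangular (Suc b) + Suc b * (b + k)) * (-1) ^ b :: int fps"
  let ?s = "\<lambda>b i. q ^ (i * (i + e b)) * (inv_qpoch i * inv_qpoch (i + e b))"
  have "qsum (\<lambda>x. \<Sum>b\<le>x. ?c b * ?s b (x - b)) = qsum (\<lambda>b. qsum (\<lambda>i. ?c b * ?s b i))"
  proof (rule qsum_triangle[where t="\<lambda>i b. ?c b * ?s b i"])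
    fix i b n :: nat assume n: "n < i + b"
    have "?c b * ?s b i = q ^ (triangular (Suc b) + Suc b * (b + k) + i * (i + e b)) * ((-1) ^ b * (inv_qpoch i * inv_qpoch (i + e b)))"
      by (simp add: power_add mult_ac)
    moreover have "i \<le> i * (i + e b)" by (cases i) auto
    then have "n < triangular (Suc b) + Suc b * (b + k) + i * (i + e b)" using n unfolding triangular_Suc by linarith
    ultimately show "(?c b * ?s b i) $ n = 0" by (simp only: q_pow_nth if_True)
  qed
  also have "\<dots> = qsum (\<lambda>b. part_gf * ?c b)"
  proof (rule qsum_cong)
    fix b
    have "qsummable (?s b)" by (rule qsummable_q_pow) (case_tac i; simp)
    show "qsum (\<lambda>i. ?c b * ?s b i) = part_gf * ?c b"
      unfolding qsum_mult[OF \<open>qsummable (?s b)\<close>] durfee_rectangle by (rule mult.commute)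
  qed
  also have "\<dots> = rank_theta k" unfolding rank_theta_def by (rule qsum_mult[OF qsummable_rank_theta])
  finally show ?thesis .
qed

subsection \<open>The Gaussian binomial coefficients\<close>

definition qbinom :: "nat \<Rightarrow> nat \<Rightarrow> int fps" where
  "qbinom n k = (if k \<le> n then qpoch n * (inv_qpoch k * inv_qpoch (n - k)) else 0)"

lemma qbinom_0 [simp]: "qbinom n 0 = 1"
  by (simp add: qbinom_def qpoch_inv_qpoch)

lemma qbinom_self [simp]: "qbinom n n = 1"
  by (simp add: qbinom_def qpoch_inv_qpoch)

lemma qbinom_eq_0 [simp]: "n < k \<Longrightarrow> qbinom n k = 0"
  by (simp add: qbinom_def)

lemma qbinom_Suc_Suc: "qbinom (Suc n) (Suc k) = qbinom n k + q ^ Suc k * qbinom n (Suc k)"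
  and qbinom_Suc_Suc': "k \<le> n \<Longrightarrow> qbinom (Suc n) (Suc k) = q ^ (n - k) * qbinom n k + qbinom n (Suc k)"
proof -
  consider "k > n" | "k = n" | j where "n = Suc k + j"
    by (cases k n rule: linorder_cases) (auto dest: less_imp_Suc_add)
  then have "qbinom (Suc n) (Suc k) = qbinom n k + q ^ Suc k * qbinom n (Suc k) \<and>
    (k \<le> n \<longrightarrow> qbinom (Suc n) (Suc k) = q ^ (n - k) * qbinom n k + qbinom n (Suc k))"
  proof cases
    case 3
    have 1: "qbinom n k = qpoch n * (inv_qpoch k * inv_qpoch (Suc j))" "qbinom n (Suc k) = qpoch n * (inv_qpoch (Suc k) * inv_qpoch j)"
      "qbinom (Suc n) (Suc k) = qpoch (Suc n) * (inv_qpoch (Suc k) * inv_qpoch (Suc j))"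
      by (simp_all add: qbinom_def 3 Suc_diff_le)
    have 2: "qpoch (Suc n) = (1 - q ^ Suc k * q ^ Suc j) * qpoch n"
      unfolding qpoch_Suc 3 power_add[symmetric] by simp
    have 3: "n - k = Suc j" using 3 by simp
    show ?thesis unfolding 1 2 3 inv_qpoch_rec[of k] inv_qpoch_rec[of j] by (simp add: algebra_simps del: power_Suc)
  qed auto
  then show "qbinom (Suc n) (Suc k) = qbinom n k + q ^ Suc k * qbinom n (Suc k)"
    "k \<le> n \<Longrightarrow> qbinom (Suc n) (Suc k) = q ^ (n - k) * qbinom n k + qbinom n (Suc k)" by auto
qed

lemma qbinom_step: "k \<le> n \<Longrightarrow> qbinom n (Suc k) * (1 - q ^ Suc k) = qbinom n k * (1 - q ^ (n - k))"
proof (cases "k = n")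
  case False
  assume "k \<le> n"
  with False obtain j where j: "n = Suc k + j" using less_imp_Suc_add[of k n] by auto
  have 1: "qbinom n k = qpoch n * (inv_qpoch k * inv_qpoch (Suc j))" "qbinom n (Suc k) = qpoch n * (inv_qpoch (Suc k) * inv_qpoch j)"
    by (simp_all add: qbinom_def j)
  have 3: "n - k = Suc j" using j by simp
  show ?thesis unfolding 1 3 inv_qpoch_rec[of k] inv_qpoch_rec[of j] by (simp only: mult_ac)
qed simp

text \<open>Pascal's rule summed against f: a step in n becomes the substitution of q^e f(e) +
  f(e+1) for f(e). Both \<open>q_vandermonde\<close> and \<open>dm_kernel_diff\<close> rest on
  it.\<close>

lemma sum_qbinom_Suc:
  "(\<Sum>e\<le>Suc n. qbinom (Suc n) e * f e) = (\<Sum>e\<le>n. qbinom n e * (q ^ e * f e + f (Suc e)))"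
proof -
  have "(\<Sum>e\<le>Suc n. qbinom (Suc n) e * f e)
      = f 0 + (\<Sum>e\<le>n. qbinom n e * f (Suc e) + q ^ Suc e * qbinom n (Suc e) * f (Suc e))"
    unfolding sum.atMost_Suc_shift qbinom_Suc_Suc by (simp add: algebra_simps)
  also have "\<dots> = (\<Sum>e\<le>n. qbinom n e * f (Suc e)) + (\<Sum>e\<le>Suc n. q ^ e * qbinom n e * f e)"
    unfolding sum.atMost_Suc_shift sum.distrib by simp
  also have "\<dots> = (\<Sum>e\<le>n. qbinom n e * (q ^ e * f e + f (Suc e)))"
    by (simp add: sum.distrib[symmetric] algebra_simps)
  finally show ?thesis .
qed

text \<open>The Durfee rectangle count for parts at most n + a: e rows of length e + a, an e by n -
  e box to their right, parts at most e + a below.\<close>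

lemma q_vandermonde: "(\<Sum>e\<le>n. qbinom n e * (q ^ (e * (e + a)) * inv_qpoch (e + a))) = inv_qpoch (n + a)"
proof (induction n arbitrary: a)
  case (Suc n)
  have "q ^ e * (q ^ (e * (e + a)) * inv_qpoch (e + a)) + q ^ (Suc e * (Suc e + a)) * inv_qpoch (Suc e + a)
      = q ^ (e * (e + Suc a)) * inv_qpoch (e + Suc a)" for e
  proof -
    have 1: "q ^ (Suc e * (Suc e + a)) = q ^ e * q ^ (e * (e + a)) * q ^ Suc (e + a)"
      unfolding power_add[symmetric] by (rule arg_cong[of _ _ "(^) q"]) (simp add: algebra_simps)
    have 2: "q ^ (e * (e + Suc a)) = q ^ e * q ^ (e * (e + a))"
      by (rule q_pow_split) (simp add: algebra_simps)
    show ?thesis unfolding 1 2 unfolding add_Suc add_Suc_right inv_qpoch_rec[of "e + a"] by (simp add: algebra_simps del: power_Suc)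
  qed
  then show ?case unfolding sum_qbinom_Suc Suc.IH[of "Suc a", symmetric, simplified add_Suc_right add_Suc[symmetric]]
    by simp
qed simp

section \<open>The kernel of the doubly marked partitions and its first difference in l\<close>

text \<open>
  In \<open>dm_kernel g l\<close> the summation index is \<open>e = s - 1\<close>, and the \<open>g\<close> of a doubly marked partition is \<open>Suc g\<close> here.
\<close>

definition dm_kernel :: "nat \<Rightarrow> nat \<Rightarrow> int fps" where
  "dm_kernel g l = inv_qpoch g * (\<Sum>e<l. qbinom (l - 1) e * (q ^ (e * Suc e) * (inv_qpoch e * geom_series (Suc (e + g)))))"

text \<open>Collects the summands that still carry a geometric series after \<open>dm_kernel\<close>
  is differenced in l.\<close>

definition kernel_diff :: "nat \<Rightarrow> nat \<Rightarrow> int fps" where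
  "kernel_diff g n = (\<Sum>e\<le>n. qbinom n e * (q ^ (Suc e * Suc e) * (inv_qpoch (Suc e) * geom_series (Suc (e + g)))))"

lemma geom_series_unit: "q ^ Suc n * geom_series (Suc n) = geom_series (Suc n) - 1"
  using geom_series_inv[of "Suc n"] by (simp add: algebra_simps)

text \<open>The factor q^(g+1) is what raising l by one adds to q^((g+1) l). Since q^(e+g+1) times
  its geometric series is that series minus 1, the series of index e + g + 1 cancels; the part
  without geometric series is summed by \<open>q_vandermonde\<close> at a = 1.\<close>

lemma dm_kernel_diff: "dm_kernel g (Suc n) - q ^ Suc g * dm_kernel g (Suc (Suc n)) = inv_qpoch g * inv_qpoch (Suc n) - inv_qpoch g * kernel_diff (Suc g) n"
proof -
  let ?f = "\<lambda>e. q ^ (e * Suc e) * (inv_qpoch e * geom_series (Suc (e + g)))"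
  let ?h = "\<lambda>e. q ^ (Suc e * Suc e) * (inv_qpoch (Suc e) * geom_series (Suc (e + Suc g)))"
  have "?f e - q ^ Suc g * (q ^ e * ?f e + ?f (Suc e)) = q ^ (e * (e + 1)) * inv_qpoch (e + 1) - ?h e" for e
  proof -
    let ?G = "geom_series (Suc (e + g))" and ?H = "geom_series (Suc (e + Suc g))"
    have "q ^ Suc g * q ^ e * ?G = q ^ Suc (e + g) * ?G" by (simp add: power_add mult_ac)
    then have 1: "q ^ Suc g * q ^ e * ?G = ?G - 1" unfolding geom_series_unit .
    have "q ^ Suc g * q ^ (Suc e * Suc (Suc e)) = q ^ (Suc e * Suc e) * q ^ Suc (e + Suc g)"
      unfolding power_add[symmetric] by (rule arg_cong[of _ _ "(^) q"]) (simp add: algebra_simps)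
    then have "q ^ Suc g * q ^ (Suc e * Suc (Suc e)) * ?H = q ^ (Suc e * Suc e) * (q ^ Suc (e + Suc g) * ?H)"
      by (simp only: mult_ac)
    then have 2: "q ^ Suc g * q ^ (Suc e * Suc (Suc e)) * ?H = q ^ (Suc e * Suc e) * (?H - 1)"
      unfolding geom_series_unit .
    have 3: "q ^ (Suc e * Suc e) = q ^ (e * Suc e) * q ^ Suc e" by (rule q_pow_split) simp
    have "?f e - q ^ Suc g * (q ^ e * ?f e + ?f (Suc e)) =
        q ^ (e * Suc e) * inv_qpoch e * (?G - q ^ Suc g * q ^ e * ?G)
        - q ^ Suc g * q ^ (Suc e * Suc (Suc e)) * ?H * inv_qpoch (Suc e)"
      by (simp add: algebra_simps del: power_Suc mult_Suc mult_Suc_right)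
    also have "\<dots> = q ^ (e * Suc e) * (inv_qpoch e + q ^ Suc e * inv_qpoch (Suc e)) - ?h e"
      unfolding 1 2 unfolding 3 by (simp add: algebra_simps del: power_Suc mult_Suc mult_Suc_right)
    also have "inv_qpoch e + q ^ Suc e * inv_qpoch (Suc e) = inv_qpoch (Suc e)"
      unfolding inv_qpoch_rec[of e] by (simp add: algebra_simps)
    finally show ?thesis by simp
  qed note 1 = this
  have "dm_kernel g (Suc n) - q ^ Suc g * dm_kernel g (Suc (Suc n))
     = inv_qpoch g * ((\<Sum>e\<le>n. qbinom n e * ?f e) - q ^ Suc g * (\<Sum>e\<le>n. qbinom n e * (q ^ e * ?f e + ?f (Suc e))))"
    unfolding dm_kernel_def lessThan_Suc_atMost diff_Suc_1 sum_qbinom_Suc by (simp only: right_diff_distrib mult_ac)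
  also have "\<dots> = inv_qpoch g * (\<Sum>e\<le>n. qbinom n e * (?f e - q ^ Suc g * (q ^ e * ?f e + ?f (Suc e))))"
    by (simp only: sum_distrib_left sum_subtractf right_diff_distrib mult_ac)
  also have "\<dots> = inv_qpoch g * (inv_qpoch (n + 1) - kernel_diff (Suc g) n)"
    unfolding 1 q_vandermonde[of n 1, symmetric] kernel_diff_def by (simp only: right_diff_distrib sum_subtractf)
  finally show ?thesis by (simp add: right_diff_distrib)
qed

text \<open>Both sides are reduced modulo 1 - x, where x is the power of q in the geometric series.
  At g = 0 the factor 1 - q^g is zero, so the recursion itself supplies the value at g = 1.\<close>

lemma kernel_diff_rec: "(1 - q ^ (Suc g + Suc n)) * kernel_diff (Suc g) n
   = (1 - q ^ Suc g) * (1 - q ^ g) * kernel_diff g n + q ^ Suc g * inv_qpoch (Suc n)"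
proof -
  define c where "c e = q ^ (Suc e * Suc e) * qbinom n e * inv_qpoch (Suc e)" for e
  define d where "d e = q ^ (e * e) * qbinom n e * (1 - q ^ e) * inv_qpoch e * geom_series (Suc (e + g))" for e
  have L: "(1 - q ^ (Suc g + Suc n)) * kernel_diff (Suc g) n
     = (\<Sum>e\<le>n. c e * (1 - q ^ (n - e)) * geom_series (Suc (e + Suc g))) + (\<Sum>e\<le>n. c e * q ^ (n - e))"
    unfolding kernel_diff_def sum_distrib_left sum.distrib[symmetric]
  proof (rule sum.cong[OF refl])
    fix e assume "e \<in> {..n}"
    then have 1: "q ^ (Suc g + Suc n) = q ^ (n - e) * q ^ Suc (e + Suc g)" by (intro q_pow_split) simp
    let ?G = "geom_series (Suc (e + Suc g))"
    have "(1 - q ^ (Suc g + Suc n)) * ?G = ?G - q ^ (n - e) * (q ^ Suc (e + Suc g) * ?G)"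
      unfolding 1 by (simp add: left_diff_distrib mult.assoc del: power_Suc)
    then have "(1 - q ^ (Suc g + Suc n)) * ?G = (1 - q ^ (n - e)) * ?G + q ^ (n - e)"
      unfolding geom_series_unit by (simp add: algebra_simps)
    then have "c e * ((1 - q ^ (Suc g + Suc n)) * ?G) = c e * ((1 - q ^ (n - e)) * ?G + q ^ (n - e))" by simp
    then show "(1 - q ^ (Suc g + Suc n)) * (qbinom n e * (q ^ (Suc e * Suc e) * (inv_qpoch (Suc e) * ?G)))
      = c e * (1 - q ^ (n - e)) * ?G + c e * q ^ (n - e)"
      unfolding c_def by (simp only: distrib_left mult_ac)
  qed
  have R: "(1 - q ^ Suc g) * (1 - q ^ g) * kernel_diff g n
     = (\<Sum>e\<le>n. d e) + (\<Sum>e\<le>n. q ^ (e * e) * qbinom n e * inv_qpoch (Suc e) * (q ^ e + q ^ Suc e - 1 - q ^ Suc (e + g)))"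
    unfolding kernel_diff_def sum_distrib_left sum.distrib[symmetric]
  proof (rule sum.cong[OF refl])
    fix e
    let ?G = "geom_series (Suc (e + g))" and ?x = "q ^ Suc (e + g)"
    have 1: "q ^ (Suc e * Suc e) = q ^ (e * e) * (q ^ e * q ^ Suc e)"
      unfolding power_add[symmetric] by (rule arg_cong[of _ _ "(^) q"]) (simp add: algebra_simps)
    have 2: "q ^ e * (1 - q ^ Suc g) = q ^ e - ?x" "q ^ Suc e * (1 - q ^ g) = q ^ Suc e - ?x"
      by (simp_all add: power_add algebra_simps)
    have 3: "d e = q ^ (e * e) * qbinom n e * ((1 - q ^ e) * ((1 - q ^ Suc e) * inv_qpoch (Suc e)) * ?G)"
      unfolding d_def inv_qpoch_rec[of e] by (simp only: mult_ac)
    \<comment> \<open>Division of (q^e - x)(q^(e+1) - x) by 1 - x; the remainder is the value at x =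
      1.\<close>
    have "(q ^ e - ?x) * (q ^ Suc e - ?x) * ?G
        = (1 - q ^ e) * (1 - q ^ Suc e) * ?G + (q ^ e + q ^ Suc e - 1 - ?x) * (?G - ?x * ?G)"
      by (simp add: algebra_simps)
    then have 4: "(q ^ e - ?x) * (q ^ Suc e - ?x) * ?G
        = (1 - q ^ e) * (1 - q ^ Suc e) * ?G + (q ^ e + q ^ Suc e - 1 - ?x)"
      unfolding geom_series_unit by simp
    have "(1 - q ^ Suc g) * (1 - q ^ g) * (qbinom n e * (q ^ (Suc e * Suc e) * (inv_qpoch (Suc e) * ?G)))
        = qbinom n e * (q ^ (e * e) * inv_qpoch (Suc e)) * ((q ^ e * (1 - q ^ Suc g)) * (q ^ Suc e * (1 - q ^ g)) * ?G)"
      unfolding 1 by (simp only: mult_ac)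
    also have "\<dots> = d e + q ^ (e * e) * qbinom n e * inv_qpoch (Suc e) * (q ^ e + q ^ Suc e - 1 - ?x)"
      unfolding 2 4 3 by (simp only: distrib_left mult_ac)
    finally show "(1 - q ^ Suc g) * (1 - q ^ g) * (qbinom n e * (q ^ (Suc e * Suc e) * (inv_qpoch (Suc e) * ?G))) = \<dots>" .
  qed
  \<comment> \<open>The remainders on the two sides agree after a shift of e: \<open>d 0\<close>
    vanishes by 1 - q^0, and \<open>d (Suc n)\<close> by the Gaussian binomial.\<close>
  have shift: "(\<Sum>e\<le>n. d e) = (\<Sum>e\<le>n. c e * (1 - q ^ (n - e)) * geom_series (Suc (e + Suc g)))"
  proof -
    have "(\<Sum>e\<le>n. d e) = (\<Sum>e\<le>Suc n. d e)" by (simp add: d_def)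
    also have "\<dots> = (\<Sum>e\<le>n. d (Suc e))"
      unfolding sum.atMost_Suc_shift by (simp add: d_def)
    also have "\<dots> = (\<Sum>e\<le>n. c e * (1 - q ^ (n - e)) * geom_series (Suc (e + Suc g)))"
    proof (rule sum.cong[OF refl])
      fix e assume "e \<in> {..n}"
      then have "qbinom n (Suc e) * (1 - q ^ Suc e) = qbinom n e * (1 - q ^ (n - e))" by (intro qbinom_step) simp
      moreover have "d (Suc e) = q ^ (Suc e * Suc e) * (qbinom n (Suc e) * (1 - q ^ Suc e)) * inv_qpoch (Suc e) * geom_series (Suc (Suc e + g))"
        unfolding d_def by (simp only: mult_ac)
      ultimately have "d (Suc e) = q ^ (Suc e * Suc e) * (qbinom n e * (1 - q ^ (n - e))) * inv_qpoch (Suc e) * geom_series (Suc (Suc e + g))"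
        by simp
      then show "d (Suc e) = c e * (1 - q ^ (n - e)) * geom_series (Suc (e + Suc g))"
        unfolding c_def add_Suc_shift by (simp only: mult_ac)
    qed
    finally show ?thesis .
  qed
  \<comment> \<open>The parts without geometric series combine into the \<open>q_vandermonde\<close>
    sums for a = 1 and a = 0.\<close>
  have "(\<Sum>e\<le>n. c e * q ^ (n - e)) -
      (\<Sum>e\<le>n. q ^ (e * e) * qbinom n e * inv_qpoch (Suc e) * (q ^ e + q ^ Suc e - 1 - q ^ Suc (e + g)))
     = (\<Sum>e\<le>n. (q ^ Suc n - 1 + q ^ Suc g) * (qbinom n e * (q ^ (e * (e + 1)) * inv_qpoch (e + 1)))
          + qbinom n e * (q ^ (e * (e + 0)) * inv_qpoch (e + 0)))"
    unfolding sum_subtractf[symmetric]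
  proof (rule sum.cong[OF refl])
    fix e assume "e \<in> {..n}"
    then have 1: "q ^ (Suc e * Suc e) * q ^ (n - e) = q ^ (e * e) * q ^ e * q ^ Suc n"
      unfolding power_add[symmetric] by (intro arg_cong[of _ _ "(^) q"]) simp
    have 2: "q ^ (e * (e + 1)) = q ^ (e * e) * q ^ e" by (rule q_pow_split) simp
    have 3: "q ^ Suc (e + g) = q ^ e * q ^ Suc g" by (simp add: power_add)
    have "c e * q ^ (n - e) = (q ^ (Suc e * Suc e) * q ^ (n - e)) * (qbinom n e * inv_qpoch (Suc e))"
      unfolding c_def by (simp only: mult_ac)
    then have 4: "c e * q ^ (n - e) = q ^ (e * e) * q ^ e * q ^ Suc n * (qbinom n e * inv_qpoch (Suc e))"
      unfolding 1 .
    show "c e * q ^ (n - e) - q ^ (e * e) * qbinom n e * inv_qpoch (Suc e) * (q ^ e + q ^ Suc e - 1 - q ^ Suc (e + g))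
      = (q ^ Suc n - 1 + q ^ Suc g) * (qbinom n e * (q ^ (e * (e + 1)) * inv_qpoch (e + 1)))
          + qbinom n e * (q ^ (e * (e + 0)) * inv_qpoch (e + 0))"
      unfolding 2 3 4 unfolding add_0_right Suc_eq_plus1[symmetric] inv_qpoch_rec[of e]
      by (simp add: algebra_simps del: power_Suc)
  qed
  also have "\<dots> = (q ^ Suc n - 1 + q ^ Suc g) * inv_qpoch (Suc n) + inv_qpoch n"
    unfolding sum.distrib sum_distrib_left[symmetric] q_vandermonde by simp
  also have "\<dots> = q ^ Suc g * inv_qpoch (Suc n)"
    unfolding inv_qpoch_rec[of n] by (simp add: algebra_simps)
  finally show ?thesis unfolding L R shift by (simp only: diff_eq_eq add_ac)
qed

section \<open>Alternating sums for the rank part\<close>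

text \<open>
  Partial fractions in \<open>x\<close> show that \<open>rank_term g l\<close> counts the pairs of a partition into parts \<open>\<le> g\<close> and a partition
  into parts \<open>\<le> l\<close> in which the first has more parts than the second, and \<open>rank_term2 g l\<close> counts the remaining
  pairs if \<open>l > 0\<close>. Only the recursions in \<open>g\<close> are needed.
\<close>

definition rank_term :: "nat \<Rightarrow> nat \<Rightarrow> int fps" where
  "rank_term g l = (\<Sum>b<g. (-1) ^ b * q ^ triangular (Suc b) * (inv_qpoch (g - Suc b) * inv_qpoch (Suc b + l)))"

definition rank_term2 :: "nat \<Rightarrow> nat \<Rightarrow> int fps" where
  "rank_term2 g l = (\<Sum>c<l. (-1) ^ c * q ^ triangular c * (inv_qpoch (l - Suc c) * inv_qpoch (Suc c + g)))"

lemma split_factor: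
  "n = a + b \<Longrightarrow> 1 - q ^ n = (1 - q ^ a) + q ^ a * (1 - q ^ b)"
  by (simp add: power_add algebra_simps)

lemma inv_qpoch_pred: "n > 0 \<Longrightarrow> (1 - q ^ n) * inv_qpoch n = inv_qpoch (n - 1)"
  using inv_qpoch_rec[of "n - 1"] by simp

text \<open>1 - q^(g+l+1) is split so that one piece lowers the first index and the other the
  second. The second piece is the sum of \<open>rank_term g l\<close> shifted by one, with opposite
  sign and one extra leading term.\<close>

lemma rank_term_rec: "(1 - q ^ (Suc g + l)) * rank_term (Suc g) l = (1 - q ^ Suc g) * rank_term g l + q ^ Suc g * (inv_qpoch g * inv_qpoch l)"
proof -
  let ?s = "\<lambda>b. (-1) ^ b * q ^ triangular (Suc b) :: int fps" and ?r = "\<lambda>b. (-1) ^ b * q ^ triangular b :: int fps"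
  have "(1 - q ^ (Suc g + l)) * rank_term (Suc g) l
     = (\<Sum>b\<le>g. ?s b * ((1 - q ^ (g - b)) * inv_qpoch (g - b) * inv_qpoch (Suc b + l))
         + q ^ Suc g * (?r b * (inv_qpoch (g - b) * inv_qpoch (b + l))))"
    unfolding rank_term_def sum_distrib_left lessThan_Suc_atMost
  proof (rule sum.cong[OF refl])
    fix b assume "b \<in> {..g}"
    then have 1: "1 - q ^ (Suc g + l) = (1 - q ^ (g - b)) + q ^ (g - b) * (1 - q ^ Suc (b + l))"
      by (intro split_factor) simp
    have 2: "q ^ triangular (Suc b) * q ^ (g - b) = q ^ Suc g * q ^ triangular b"
      unfolding power_add[symmetric] using \<open>b \<in> {..g}\<close> by (intro arg_cong[of _ _ "(^) q"]) (simp add: triangular_Suc)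
    have "(1 - q ^ (Suc g + l)) * (?s b * (inv_qpoch (Suc g - Suc b) * inv_qpoch (Suc b + l)))
      = ?s b * ((1 - q ^ (g - b)) * inv_qpoch (g - b) * inv_qpoch (Suc b + l))
         + (q ^ triangular (Suc b) * q ^ (g - b)) * ((-1) ^ b * (inv_qpoch (g - b) * ((1 - q ^ Suc (b + l)) * inv_qpoch (Suc (b + l)))))"
      unfolding 1 unfolding distrib_right diff_Suc_Suc add_Suc by (simp only: mult_ac)
    then show "(1 - q ^ (Suc g + l)) * (?s b * (inv_qpoch (Suc g - Suc b) * inv_qpoch (Suc b + l)))
      = ?s b * ((1 - q ^ (g - b)) * inv_qpoch (g - b) * inv_qpoch (Suc b + l))
         + q ^ Suc g * (?r b * (inv_qpoch (g - b) * inv_qpoch (b + l)))"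
      unfolding 2 inv_qpoch_rec[symmetric] by (simp only: mult_ac)
  qed
  also have "\<dots> = (\<Sum>b\<le>g. ?s b * ((1 - q ^ (g - b)) * inv_qpoch (g - b) * inv_qpoch (Suc b + l)))
       + q ^ Suc g * (\<Sum>b\<le>g. ?r b * (inv_qpoch (g - b) * inv_qpoch (b + l)))"
    by (simp only: sum.distrib sum_distrib_left)
  also have "(\<Sum>b\<le>g. ?s b * ((1 - q ^ (g - b)) * inv_qpoch (g - b) * inv_qpoch (Suc b + l))) = rank_term g l"
    unfolding rank_term_def lessThan_Suc_atMost[symmetric] sum.lessThan_Suc by (simp add: inv_qpoch_pred)
  also have "(\<Sum>b\<le>g. ?r b * (inv_qpoch (g - b) * inv_qpoch (b + l))) = inv_qpoch g * inv_qpoch l - rank_term g l"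
  proof (cases g)
    case (Suc m)
    show ?thesis unfolding Suc sum.atMost_Suc_shift rank_term_def lessThan_Suc_atMost by (simp add: sum_negf)
  qed (simp add: rank_term_def)
  finally show ?thesis by (simp add: algebra_simps)
qed

text \<open>The prefactor absorbs one of the two factors in \<open>kernel_diff_rec\<close>, which
  leaves exactly the recursion \<open>rank_term_rec\<close>.\<close>

lemma kernel_diff_eq_rank_term: "inv_qpoch g * kernel_diff (Suc g) n = rank_term (Suc g) (Suc n)"
proof (induction g)
  case 0
  have "(1 - q ^ (Suc 0 + Suc n)) * kernel_diff (Suc 0) n = (1 - q ^ (Suc 0 + Suc n)) * rank_term (Suc 0) (Suc n)"
    unfolding kernel_diff_rec rank_term_rec by (simp add: rank_term_def)
  then show ?case unfolding inv_qpoch_0 mult_1 by (rule q_pow_cancel[rotated]) simp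
next
  case (Suc g)
  have "(1 - q ^ (Suc (Suc g) + Suc n)) * (inv_qpoch (Suc g) * kernel_diff (Suc (Suc g)) n)
      = inv_qpoch (Suc g) * ((1 - q ^ (Suc (Suc g) + Suc n)) * kernel_diff (Suc (Suc g)) n)" by (simp only: mult_ac)
  also have "\<dots> = (1 - q ^ Suc (Suc g)) * (((1 - q ^ Suc g) * inv_qpoch (Suc g)) * kernel_diff (Suc g) n)
      + q ^ Suc (Suc g) * (inv_qpoch (Suc g) * inv_qpoch (Suc n))"
    unfolding kernel_diff_rec by (simp only: distrib_left mult_ac)
  also have "\<dots> = (1 - q ^ (Suc (Suc g) + Suc n)) * rank_term (Suc (Suc g)) (Suc n)"
    unfolding inv_qpoch_rec[symmetric] rank_term_rec Suc.IH ..
  finally show ?case by (rule q_pow_cancel[rotated]) simp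
qed

text \<open>All pairs minus \<open>rank_term2\<close>, as a single sum with exponents c(c - 1)/2, so
  that the splitting argument applies term by term.\<close>

definition rank_coterm :: "nat \<Rightarrow> nat \<Rightarrow> int fps" where
  "rank_coterm g l = (\<Sum>c\<le>l. (-1) ^ c * q ^ (\<Sum>{..<c}) * (inv_qpoch (l - c) * inv_qpoch (c + g)))"

lemma sum_lessThan_triangular: "\<Sum>{..<Suc c} = triangular c"
  by (simp add: triangular_def lessThan_Suc_atMost)

lemma rank_coterm_eq: "rank_coterm g l = inv_qpoch g * inv_qpoch l - rank_term2 g l"
proof (cases l)
  case (Suc m)
  show ?thesis unfolding rank_coterm_def Suc sum.atMost_Suc_shift sum_lessThan_triangular
    unfolding rank_term2_def lessThan_Suc_atMost
    by (simp add: sum_negf[symmetric])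
qed (simp add: rank_coterm_def rank_term2_def)

lemma rank_coterm_split: "(1 - q ^ (g + l)) * rank_coterm g l
   = (\<Sum>c\<le>l. (-1) ^ c * q ^ (\<Sum>{..<c}) * (inv_qpoch (l - c) * ((1 - q ^ (c + g)) * inv_qpoch (c + g))))
     + q ^ g * (\<Sum>c<l. (-1) ^ c * q ^ triangular c * (inv_qpoch (l - Suc c) * inv_qpoch (c + g)))"
proof -
  let ?s = "\<lambda>c. (-1) ^ c * q ^ (\<Sum>{..<c}) :: int fps"
  have "(1 - q ^ (g + l)) * rank_coterm g l
     = (\<Sum>c\<le>l. ?s c * (inv_qpoch (l - c) * ((1 - q ^ (c + g)) * inv_qpoch (c + g)))
         + q ^ g * (?s c * q ^ c * ((1 - q ^ (l - c)) * inv_qpoch (l - c) * inv_qpoch (c + g))))"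
    unfolding rank_coterm_def sum_distrib_left
  proof (rule sum.cong[OF refl])
    fix c assume "c \<in> {..l}"
    then have 1: "1 - q ^ (g + l) = (1 - q ^ (c + g)) + q ^ (c + g) * (1 - q ^ (l - c))"
      by (intro split_factor) simp
    show "(1 - q ^ (g + l)) * (?s c * (inv_qpoch (l - c) * inv_qpoch (c + g)))
      = ?s c * (inv_qpoch (l - c) * ((1 - q ^ (c + g)) * inv_qpoch (c + g)))
         + q ^ g * (?s c * q ^ c * ((1 - q ^ (l - c)) * inv_qpoch (l - c) * inv_qpoch (c + g)))"
      unfolding 1 distrib_right power_add[of q c g] by (simp only: mult_ac)
  qed
  also have "\<dots> = (\<Sum>c\<le>l. ?s c * (inv_qpoch (l - c) * ((1 - q ^ (c + g)) * inv_qpoch (c + g))))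
     + q ^ g * (\<Sum>c\<le>l. ?s c * q ^ c * ((1 - q ^ (l - c)) * inv_qpoch (l - c) * inv_qpoch (c + g)))"
    by (simp only: sum.distrib sum_distrib_left)
  also have "(\<Sum>c\<le>l. ?s c * q ^ c * ((1 - q ^ (l - c)) * inv_qpoch (l - c) * inv_qpoch (c + g)))
     = (\<Sum>c<l. ?s c * q ^ c * ((1 - q ^ (l - c)) * inv_qpoch (l - c) * inv_qpoch (c + g)))"
    by (simp add: lessThan_Suc_atMost[symmetric])
  also have "\<dots> = (\<Sum>c<l. (-1) ^ c * q ^ triangular c * (inv_qpoch (l - Suc c) * inv_qpoch (c + g)))"
  proof (intro sum.cong refl)
    fix c assume "c \<in> {..<l}"
    then have 1: "(1 - q ^ (l - c)) * inv_qpoch (l - c) = inv_qpoch (l - Suc c)" by (simp add: inv_qpoch_pred)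
    have 2: "q ^ triangular c = q ^ (\<Sum>{..<c}) * q ^ c"
      by (rule q_pow_split) (simp add: sum_lessThan_triangular[symmetric])
    show "?s c * q ^ c * ((1 - q ^ (l - c)) * inv_qpoch (l - c) * inv_qpoch (c + g))
      = (-1) ^ c * q ^ triangular c * (inv_qpoch (l - Suc c) * inv_qpoch (c + g))"
      unfolding 1 2 by (simp only: mult_ac)
  qed
  finally show ?thesis .
qed

lemma rank_coterm_rec: "(1 - q ^ (Suc g + l)) * rank_coterm (Suc g) l = (1 - q ^ Suc g) * rank_coterm g l + q ^ Suc g * (inv_qpoch g * inv_qpoch l)"
proof -
  have "(1 - q ^ (Suc g + l)) * rank_coterm (Suc g) l = rank_coterm g l + q ^ Suc g * rank_term2 g l"
    unfolding rank_coterm_split unfolding add_Suc_right inv_qpoch_rec[symmetric] rank_coterm_def rank_term2_def add_Suc ..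
  then show ?thesis unfolding rank_coterm_eq by (simp add: algebra_simps)
qed

text \<open>In \<open>rank_coterm_split\<close> the term c = 0 vanishes with 1 - q^0; after a shift
  the remaining terms cancel against the second sum.\<close>

lemma rank_coterm_0: "rank_coterm 0 (Suc n) = 0"
proof -
  have "(1 - q ^ (0 + Suc n)) * rank_coterm 0 (Suc n) = 0"
    unfolding rank_coterm_split sum.atMost_Suc_shift sum_lessThan_triangular
    unfolding lessThan_Suc_atMost add_0_right inv_qpoch_rec[symmetric] by (simp add: sum_negf)
  then show ?thesis using q_pow_cancel[of "0 + Suc n" "rank_coterm 0 (Suc n)" 0] by simp
qed

text \<open>With \<open>rank_coterm_eq\<close>, this is the complementarity of
  \<open>rank_term\<close> and \<open>rank_term2\<close> for l > 0.\<close>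

lemma rank_coterm_eq_rank_term: "rank_coterm g (Suc n) = rank_term g (Suc n)"
proof (induction g)
  case (Suc g)
  have "(1 - q ^ (Suc g + Suc n)) * rank_coterm (Suc g) (Suc n) = (1 - q ^ (Suc g + Suc n)) * rank_term (Suc g) (Suc n)"
    unfolding rank_coterm_rec rank_term_rec Suc.IH ..
  then show ?case by (rule q_pow_cancel[rotated]) simp
qed (simp add: rank_coterm_0 rank_term_def)

lemma dm_kernel_diff_rank_term:
  "dm_kernel g (Suc n) - q ^ Suc g * dm_kernel g (Suc (Suc n)) = inv_qpoch g * inv_qpoch (Suc n) - rank_term (Suc g) (Suc n)"
  unfolding dm_kernel_diff kernel_diff_eq_rank_term ..

text \<open>The complementary form, for nonnegative spt-crank. It includes l = 0, which occurs once
  \<open>dm_gf_pos (Suc m)\<close> is reindexed.\<close>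

lemma dm_kernel_diff_rank_term2:
  "dm_kernel g l - q ^ Suc g * dm_kernel g (Suc l) = rank_term2 (Suc g) l - q ^ Suc g * (inv_qpoch (Suc g) * inv_qpoch l)"
proof (cases l)
  case 0
  have "dm_kernel g (Suc 0) = inv_qpoch (Suc g)" by (simp add: dm_kernel_def inv_qpoch_Suc mult.commute)
  then show ?thesis by (simp add: 0 rank_term2_def dm_kernel_def)
next
  case (Suc n)
  have "dm_kernel g l - q ^ Suc g * dm_kernel g (Suc l) = inv_qpoch g * inv_qpoch l - (inv_qpoch (Suc g) * inv_qpoch l - rank_term2 (Suc g) l)"
    unfolding Suc dm_kernel_diff_rank_term rank_coterm_eq_rank_term[symmetric] rank_coterm_eq ..
  then show ?thesis unfolding inv_qpoch_rec[of g] by (simp add: algebra_simps del: power_Suc)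
qed

subsection \<open>The two generating functions agree\<close>

text \<open>The pairs g = x + 1, l = x + 1 + m; \<open>dm_gf_pos\<close> exchanges the roles. In
  both, x + 1 is the smaller of g and l.\<close>

definition dm_gf_neg :: "nat \<Rightarrow> int fps" where
  "dm_gf_neg m = qsum (\<lambda>x. q ^ (Suc x * (Suc x + m)) * dm_kernel x (Suc x + m))"

definition dm_gf_pos :: "nat \<Rightarrow> int fps" where
  "dm_gf_pos m = qsum (\<lambda>x. q ^ ((Suc x + m) * Suc x) * dm_kernel (x + m) (Suc x))"

text \<open>With y = x - b, (x+1)(x+1+m) = (b+1)(b+1+m) + y(y + 2(b+1) + m); the last product is a
  Durfee rectangle of offset 2(b+1) + m.\<close>

lemma qsum_rank_term: "qsum (\<lambda>x. q ^ (Suc x * (Suc x + m)) * rank_term (Suc x) (Suc x + m)) = rank_theta (Suc m)"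
proof -
  have "q ^ (Suc x * (Suc x + m)) * rank_term (Suc x) (Suc x + m)
     = (\<Sum>b\<le>x. q ^ (triangular (Suc b) + Suc b * (b + Suc m)) * (-1) ^ b *
      (q ^ ((x - b) * ((x - b) + (2 * Suc b + m))) * (inv_qpoch (x - b) * inv_qpoch ((x - b) + (2 * Suc b + m)))))" for x
    unfolding rank_term_def lessThan_Suc_atMost sum_distrib_left
  proof (rule sum.cong[OF refl])
    fix b assume "b \<in> {..x}"
    then obtain y where y: "x = b + y" using le_Suc_ex by auto
    have 1: "q ^ (Suc x * (Suc x + m)) = q ^ (Suc b * (b + Suc m)) * q ^ ((x - b) * ((x - b) + (2 * Suc b + m)))"
      by (rule q_pow_split) (simp add: y algebra_simps)
    have 2: "Suc b + (Suc x + m) = x - b + (2 * Suc b + m)" "Suc x - Suc b = x - b" by (simp_all add: y)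
    show "q ^ (Suc x * (Suc x + m)) * ((-1) ^ b * q ^ triangular (Suc b) * (inv_qpoch (Suc x - Suc b) * inv_qpoch (Suc b + (Suc x + m))))
     = q ^ (triangular (Suc b) + Suc b * (b + Suc m)) * (-1) ^ b *
      (q ^ ((x - b) * ((x - b) + (2 * Suc b + m))) * (inv_qpoch (x - b) * inv_qpoch ((x - b) + (2 * Suc b + m))))"
      unfolding 1 2 power_add[of q "triangular (Suc b)"] by (simp only: mult_ac)
  qed
  then show ?thesis using qsum_rank_theta[of "Suc m" "\<lambda>b. 2 * Suc b + m"] by presburger
qed

text \<open>The same reduction with offset 2(b+1) + m + 1, after the empty term l = 0 is split
  off.\<close>

lemma qsum_rank_term2: "qsum (\<lambda>l. q ^ (Suc (l + m) * l) * rank_term2 (Suc (l + m)) l) = rank_theta (Suc m)"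
proof -
  have "q ^ (Suc (Suc x + m) * Suc x) * rank_term2 (Suc (Suc x + m)) (Suc x)
     = (\<Sum>b\<le>x. q ^ (triangular (Suc b) + Suc b * (b + Suc m)) * (-1) ^ b *
      (q ^ ((x - b) * ((x - b) + (2 * Suc b + Suc m))) * (inv_qpoch (x - b) * inv_qpoch ((x - b) + (2 * Suc b + Suc m)))))" for x
    unfolding rank_term2_def lessThan_Suc_atMost sum_distrib_left
  proof (rule sum.cong[OF refl])
    fix b assume "b \<in> {..x}"
    then obtain y where y: "x = b + y" using le_Suc_ex by auto
    have 1: "q ^ (Suc (Suc x + m) * Suc x) * q ^ triangular b
      = q ^ (triangular (Suc b) + Suc b * (b + Suc m)) * q ^ ((x - b) * ((x - b) + (2 * Suc b + Suc m)))"
      unfolding power_add[symmetric] by (rule arg_cong[of _ _ "(^) q"]) (simp add: y triangular_Suc algebra_simps)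
    have 2: "Suc b + Suc (Suc x + m) = x - b + (2 * Suc b + Suc m)" "Suc x - Suc b = x - b" by (simp_all add: y)
    have "q ^ (Suc (Suc x + m) * Suc x) * ((-1) ^ b * q ^ triangular b * (inv_qpoch (Suc x - Suc b) * inv_qpoch (Suc b + Suc (Suc x + m))))
     = (q ^ (Suc (Suc x + m) * Suc x) * q ^ triangular b) * ((-1) ^ b * (inv_qpoch (x - b) * inv_qpoch ((x - b) + (2 * Suc b + Suc m))))"
      unfolding 2 by (simp only: mult_ac)
    then show "q ^ (Suc (Suc x + m) * Suc x) * ((-1) ^ b * q ^ triangular b * (inv_qpoch (Suc x - Suc b) * inv_qpoch (Suc b + Suc (Suc x + m))))
     = q ^ (triangular (Suc b) + Suc b * (b + Suc m)) * (-1) ^ b *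
      (q ^ ((x - b) * ((x - b) + (2 * Suc b + Suc m))) * (inv_qpoch (x - b) * inv_qpoch ((x - b) + (2 * Suc b + Suc m))))"
      unfolding 1 by (simp only: mult_ac)
  qed
  then have "qsum (\<lambda>x. q ^ (Suc (Suc x + m) * Suc x) * rank_term2 (Suc (Suc x + m)) (Suc x)) = rank_theta (Suc m)"
    using qsum_rank_theta[of "Suc m" "\<lambda>b. 2 * Suc b + Suc m"] by presburger
  moreover have "qsummable (\<lambda>l. q ^ (Suc (l + m) * l) * rank_term2 (Suc (l + m)) l)" by (rule qsummable_q_pow) simp
  ultimately show ?thesis by (simp only: qsum_Suc) (simp add: rank_term2_def)
qed

lemma dm_gf_neg_diff: "dm_gf_neg m - dm_gf_neg (Suc m) = crank_durfee (Suc m) - rank_theta (Suc m)"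
proof -
  have "q ^ (Suc x * (Suc x + m)) * dm_kernel x (Suc x + m) - q ^ (Suc x * (Suc x + Suc m)) * dm_kernel x (Suc x + Suc m)
      = q ^ (Suc x * (x + Suc m)) * (inv_qpoch x * inv_qpoch (x + Suc m)) - q ^ (Suc x * (Suc x + m)) * rank_term (Suc x) (Suc x + m)" for x
  proof -
    have "q ^ (Suc x * (Suc x + Suc m)) = q ^ (Suc x * (x + Suc m)) * q ^ Suc x"
      by (rule q_pow_split) (simp add: algebra_simps)
    then have "q ^ (Suc x * (Suc x + m)) * dm_kernel x (Suc x + m) - q ^ (Suc x * (Suc x + Suc m)) * dm_kernel x (Suc x + Suc m)
      = q ^ (Suc x * Suc (x + m)) * (dm_kernel x (Suc (x + m)) - q ^ Suc x * dm_kernel x (Suc (Suc (x + m))))"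
      by (simp add: right_diff_distrib mult.assoc del: power_Suc mult_Suc mult_Suc_right)
    then show ?thesis unfolding dm_kernel_diff_rank_term
      by (simp add: right_diff_distrib del: power_Suc mult_Suc mult_Suc_right)
  qed
  then have "dm_gf_neg m - dm_gf_neg (Suc m) = qsum (\<lambda>x. q ^ (Suc x * (x + Suc m)) * (inv_qpoch x * inv_qpoch (x + Suc m))
      - q ^ (Suc x * (Suc x + m)) * rank_term (Suc x) (Suc x + m))"
    unfolding dm_gf_neg_def qsum_diff[symmetric] by presburger
  then show ?thesis unfolding qsum_diff qsum_rank_term crank_durfee_def .
qed

text \<open>To compare equal g, \<open>dm_gf_pos (Suc m)\<close> is reindexed by l = x with g = x +
  m + 1; the added term l = 0 is zero.\<close>

lemma dm_gf_pos_diff: "dm_gf_pos (Suc m) - dm_gf_pos m = rank_theta (Suc m) - crank_durfee (Suc m)"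
proof -
  let ?h = "\<lambda>l. q ^ (Suc (l + m) * l) * dm_kernel (l + m) l"
  have qsummable: "qsummable ?h" by (rule qsummable_q_pow) simp
  have "dm_gf_pos (Suc m) = qsum ?h"
    unfolding qsum_Suc[OF qsummable] dm_gf_pos_def by (simp add: dm_kernel_def[of _ 0] del: mult_Suc mult_Suc_right power_Suc)
  moreover have "?h x - q ^ ((Suc x + m) * Suc x) * dm_kernel (x + m) (Suc x)
      = q ^ (Suc (x + m) * x) * rank_term2 (Suc (x + m)) x - q ^ (Suc x * (x + Suc m)) * (inv_qpoch x * inv_qpoch (x + Suc m))" for x
  proof -
    have 1: "q ^ ((Suc x + m) * Suc x) = q ^ (Suc (x + m) * x) * q ^ Suc (x + m)"
      "q ^ (Suc x * (x + Suc m)) = q ^ (Suc (x + m) * x) * q ^ Suc (x + m)"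
      by (rule q_pow_split; simp add: algebra_simps)+
    have "?h x - q ^ ((Suc x + m) * Suc x) * dm_kernel (x + m) (Suc x)
      = q ^ (Suc (x + m) * x) * (dm_kernel (x + m) x - q ^ Suc (x + m) * dm_kernel (x + m) (Suc x))"
      unfolding 1 by (simp only: right_diff_distrib mult.assoc)
    then show ?thesis unfolding dm_kernel_diff_rank_term2 unfolding 1 unfolding add_Suc_right by (simp only: right_diff_distrib mult_ac)
  qed
  ultimately have "dm_gf_pos (Suc m) - dm_gf_pos m = qsum (\<lambda>x. q ^ (Suc (x + m) * x) * rank_term2 (Suc (x + m)) x
      - q ^ (Suc x * (x + Suc m)) * (inv_qpoch x * inv_qpoch (x + Suc m)))"
    unfolding dm_gf_pos_def[of m] by (simp only: qsum_diff[symmetric])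
  then show ?thesis unfolding qsum_diff qsum_rank_term2 crank_durfee_def .
qed

section \<open>The series of the S-partitions and the comparison\<close>

definition spt_gf :: "nat \<Rightarrow> int fps" where
  "spt_gf m = qsum (\<lambda>c. (qpoch (2 * c + m) - euler) * (inv_qpoch c * inv_qpoch (c + m)))"

lemma qpoch_minus_euler: "\<exists>f. qpoch a - euler = q ^ Suc a * f"
proof -
  have "q ^ (Suc i * Suc a) * euler_tail (Suc i) = q ^ Suc a * (q ^ (i * Suc a) * euler_tail (Suc i))" for i
    by (simp add: power_add mult_ac)
  then have "qpoch a - euler = qsum (\<lambda>i. q ^ Suc a * (q ^ (i * Suc a) * euler_tail (Suc i)))"
    unfolding qsum_euler_tail[symmetric] by presburger
  also have "\<dots> = q ^ Suc a * qsum (\<lambda>i. q ^ (i * Suc a) * euler_tail (Suc i))"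
    by (intro qsum_mult qsummable_q_pow) simp
  finally show ?thesis by blast
qed

lemma qpoch_minus_euler_nth: "n \<le> a \<Longrightarrow> ((qpoch a - euler) * f) $ n = 0"
  using qpoch_minus_euler[of a] by (auto simp: mult.assoc q_pow_nth simp del: power_Suc)

lemma spt_gf_diff: "spt_gf (Suc m) - spt_gf m = rank_theta (Suc m) - crank_durfee (Suc m)"
proof -
  let ?k = "Suc m"
  let ?r = "\<lambda>c. q ^ (c + ?k) * (qpoch (2 * c + m) * (inv_qpoch c * inv_qpoch (c + ?k)) * (1 - q ^ c))"
  have "(qpoch (2 * c + ?k) - euler) * (inv_qpoch c * inv_qpoch (c + ?k)) - (qpoch (2 * c + m) - euler) * (inv_qpoch c * inv_qpoch (c + m))
      = ?r c - euler * (q ^ (c + ?k) * (inv_qpoch c * inv_qpoch (c + ?k)))" for c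
  proof -
    have 1: "qpoch (2 * c + ?k) = (1 - q ^ c * q ^ (c + ?k)) * qpoch (2 * c + m)"
      unfolding add_Suc_right qpoch_Suc power_add[symmetric] by (simp add: mult_2)
    show ?thesis unfolding 1 unfolding add_Suc_right inv_qpoch_rec[of "c + m"]
      by (simp add: algebra_simps del: power_Suc)
  qed
  then have "spt_gf (Suc m) - spt_gf m = qsum (\<lambda>c. ?r c - euler * (q ^ (c + ?k) * (inv_qpoch c * inv_qpoch (c + ?k))))"
    unfolding spt_gf_def qsum_diff[symmetric] by presburger
  also have "\<dots> = qsum ?r - crank_gf ?k"
  proof -
    have "qsummable (\<lambda>c. q ^ (c + ?k) * (inv_qpoch c * inv_qpoch (c + ?k)))" by (rule qsummable_q_pow) simp
    then show ?thesis unfolding qsum_diff crank_gf_def by (simp only: qsum_mult)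
  qed
  also have "qsum ?r = rank_gf ?k"
  proof -
    have qsummable: "qsummable ?r" by (rule qsummable_q_pow) simp
    \<comment> \<open>The factor 1 - q^c removes the term c = 0 and lowers the index of
      \<open>inv_qpoch c\<close>, which turns c = n + 1 into a term of
      \<open>rank_gf\<close>.\<close>
    have "?r (Suc n) = q ^ (n + Suc ?k) * (qpoch (2 * n + Suc ?k) * (inv_qpoch n * inv_qpoch (n + Suc ?k)))" for n
    proof -
      have 1: "2 * Suc n + m = 2 * n + Suc ?k" "Suc n + ?k = n + Suc ?k" by simp_all
      show ?thesis unfolding 1 inv_qpoch_rec[of n] by (simp only: mult_ac)
    qed
    then have "qsum (\<lambda>n. ?r (Suc n)) = rank_gf ?k"
      unfolding rank_gf_def by (rule qsum_cong)
    then show ?thesis unfolding qsum_Suc[OF qsummable] by simp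
  qed
  finally show ?thesis by (simp add: rank_gf_eq_rank_theta crank_gf_eq_crank_durfee)
qed

lemma spt_gf_vanish: "n \<le> m \<Longrightarrow> spt_gf m $ n = 0"
  by (simp add: spt_gf_def qsum_nth qpoch_minus_euler_nth)

lemma dm_gf_neg_vanish: "n \<le> m \<Longrightarrow> dm_gf_neg m $ n = 0"
  by (simp add: dm_gf_neg_def qsum_nth q_pow_nth del: power_Suc)

lemma dm_gf_pos_vanish: "n \<le> m \<Longrightarrow> dm_gf_pos m $ n = 0"
  by (simp add: dm_gf_pos_def qsum_nth q_pow_nth del: power_Suc)

text \<open>f(m) - g(m) is constant in m, so its coefficient n can be read off at m + n, where both
  series vanish.\<close>

lemma eq_of_equal_differences:
  fixes f g :: "nat \<Rightarrow> int fps"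
  assumes "\<And>m. f (Suc m) - f m = g (Suc m) - g m"
    and "\<And>m n. n \<le> m \<Longrightarrow> f m $ n = 0" "\<And>m n. n \<le> m \<Longrightarrow> g m $ n = 0"
  shows "f m = g m"
proof (rule fps_ext)
  fix n
  have step: "f (Suc m) - g (Suc m) = f m - g m" for m
    using assms(1)[of m] by (simp add: algebra_simps)
  have "f (m + k) - g (m + k) = f m - g m" for k
    by (induction k) (simp_all add: step)
  then have "f m $ n - g m $ n = f (m + n) $ n - g (m + n) $ n" by (metis fps_sub_nth)
  then show "f m $ n = g m $ n" using assms(2,3)[of n "m + n"] by simp
qed

lemma dm_gf_pos_eq_spt_gf: "dm_gf_pos m = spt_gf m"
  by (rule eq_of_equal_differences) (auto simp: dm_gf_pos_diff spt_gf_diff dm_gf_pos_vanish spt_gf_vanish)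

lemma dm_gf_neg_eq_spt_gf: "dm_gf_neg m = spt_gf m"
proof (rule eq_of_equal_differences)
  show "dm_gf_neg (Suc m) - dm_gf_neg m = spt_gf (Suc m) - spt_gf m" for m
    using dm_gf_neg_diff[of m] spt_gf_diff[of m] by (metis minus_diff_eq)
qed (auto simp: dm_gf_neg_vanish spt_gf_vanish)

subsection \<open>Generating functions of weighted sets\<close>

definition gf :: "('a \<Rightarrow> int) \<Rightarrow> ('a \<Rightarrow> nat) \<Rightarrow> 'a set \<Rightarrow> int fps" where
  "gf \<sigma> w A = Abs_fps (\<lambda>n. \<Sum>a\<in>{a \<in> A. w a = n}. \<sigma> a)"

text \<open>Over an infinite fibre the sum in \<open>gf\<close> would be the default value
  0.\<close>

definition finite_fibres :: "('a \<Rightarrow> nat) \<Rightarrow> 'a set \<Rightarrow> bool" where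
  "finite_fibres w A \<longleftrightarrow> (\<forall>n. finite {a \<in> A. w a = n})"

lemma gf_nth: "gf \<sigma> w A $ n = (\<Sum>a\<in>{a \<in> A. w a = n}. \<sigma> a)"
  by (simp add: gf_def)

lemma finite_fibres_subset:
  assumes "finite_fibres w B" "A \<subseteq> B"
  shows "finite_fibres w A"
  unfolding finite_fibres_def
proof
  fix n show "finite {a \<in> A. w a = n}"
    using assms unfolding finite_fibres_def by (intro finite_subset[of "{a \<in> A. w a = n}" "{a \<in> B. w a = n}"]) blast+
qed

lemma gf_bij:
  assumes "bij_betw f A B" "\<And>a. a \<in> A \<Longrightarrow> w' (f a) = w a" "\<And>a. a \<in> A \<Longrightarrow> \<sigma>' (f a) = \<sigma> a"
  shows "gf \<sigma>' w' B = gf \<sigma> w A"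
proof (rule fps_ext)
  fix n
  have "bij_betw f {a \<in> A. w a = n} {b \<in> B. w' b = n}"
    by (rule bij_betw_Collect[OF assms(1)]) (simp add: assms(2))
  then have "gf \<sigma>' w' B $ n = (\<Sum>a\<in>{a \<in> A. w a = n}. \<sigma>' (f a))"
    unfolding gf_nth by (rule sum.reindex_bij_betw[symmetric])
  also have "\<dots> = gf \<sigma> w A $ n"
    unfolding gf_nth by (rule sum.cong) (simp_all add: assms(3))
  finally show "gf \<sigma>' w' B $ n = gf \<sigma> w A $ n" .
qed

lemma finite_fibres_times:
  assumes "finite_fibres w A" "finite_fibres w2 B"
  shows "finite_fibres (\<lambda>(a, b). w a + w2 b) (A \<times> B)"
  unfolding finite_fibres_def
proof
  fix n
  have "{x \<in> A \<times> B. (case x of (a, b) \<Rightarrow> w a + w2 b) = n}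
      \<subseteq> (\<Union>i\<le>n. \<Union>j\<le>n. {a \<in> A. w a = i} \<times> {b \<in> B. w2 b = j})" by auto
  moreover have "finite (\<Union>i\<le>n. \<Union>j\<le>n. {a \<in> A. w a = i} \<times> {b \<in> B. w2 b = j})"
    using assms unfolding finite_fibres_def by blast
  ultimately show "finite {x \<in> A \<times> B. (case x of (a, b) \<Rightarrow> w a + w2 b) = n}"
    by (rule finite_subset)
qed

lemma gf_times:
  assumes "finite_fibres w A" "finite_fibres w2 B"
  shows "gf (\<lambda>(a, b). \<sigma> a * \<tau> b) (\<lambda>(a, b). w a + w2 b) (A \<times> B) = gf \<sigma> w A * gf \<tau> w2 B"
proof (rule fps_ext)
  fix n
  let ?A = "\<lambda>i. {a \<in> A. w a = i}" and ?B = "\<lambda>i. {b \<in> B. w2 b = i}"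
  have fin: "finite (?A i)" "finite (?B i)" for i using assms by (auto simp: finite_fibres_def)
  have "gf (\<lambda>(a, b). \<sigma> a * \<tau> b) (\<lambda>(a, b). w a + w2 b) (A \<times> B) $ n
    = (\<Sum>(i, a, b)\<in>(SIGMA i:{0..n}. ?A i \<times> ?B (n - i)). \<sigma> a * \<tau> b)"
    unfolding gf_nth
    by (rule sum.reindex_bij_witness[where i="\<lambda>(i, a, b). (a, b)" and j="\<lambda>(a, b). (w a, a, b)"]) auto
  also have "\<dots> = (\<Sum>i=0..n. \<Sum>(a, b)\<in>?A i \<times> ?B (n - i). \<sigma> a * \<tau> b)"
    by (subst sum.Sigma) (auto simp: fin)
  also have "\<dots> = (\<Sum>i=0..n. (\<Sum>a\<in>?A i. \<sigma> a) * (\<Sum>b\<in>?B (n - i). \<tau> b))"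
    by (simp add: sum_product sum.cartesian_product)
  finally show "gf (\<lambda>(a, b). \<sigma> a * \<tau> b) (\<lambda>(a, b). w a + w2 b) (A \<times> B) $ n = (gf \<sigma> w A * gf \<tau> w2 B) $ n"
    by (simp add: fps_mult_nth gf_nth)
qed

lemma gf_shift: "gf \<sigma> (\<lambda>a. k + w a) A = q ^ k * gf \<sigma> w A"
proof (rule fps_ext)
  fix n
  have "{a \<in> A. k + w a = n} = (if n < k then {} else {a \<in> A. w a = n - k})" by auto
  then show "gf \<sigma> (\<lambda>a. k + w a) A $ n = (q ^ k * gf \<sigma> w A) $ n"
    by (simp add: gf_nth q_pow_nth)
qed

lemma gf_Un:
  assumes "finite_fibres w A" "finite_fibres w B" "A \<inter> B = {}"
  shows "gf \<sigma> w (A \<union> B) = gf \<sigma> w A + gf \<sigma> w B"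
proof (rule fps_ext)
  fix n
  have "{a \<in> A \<union> B. w a = n} = {a \<in> A. w a = n} \<union> {a \<in> B. w a = n}" by auto
  then show "gf \<sigma> w (A \<union> B) $ n = (gf \<sigma> w A + gf \<sigma> w B) $ n"
    using assms unfolding gf_nth fps_add_nth finite_fibres_def by (simp only:) (rule sum.union_disjoint; auto)
qed

text \<open>The bound by the weight makes the cut in \<open>qsum\<close> harmless: an element of
  weight n has statistic at most n.\<close>

lemma gf_qsum:
  assumes "finite_fibres w A" "\<And>a. a \<in> A \<Longrightarrow> \<kappa> a \<le> w a"
  shows "gf \<sigma> w A = qsum (\<lambda>x. gf \<sigma> w {a \<in> A. \<kappa> a = x})"
proof (rule fps_ext)
  fix n
  have "{a \<in> {a \<in> A. \<kappa> a = x}. w a = n} = {a \<in> {a \<in> A. w a = n}. \<kappa> a = x}" for x by auto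
  then have "qsum (\<lambda>x. gf \<sigma> w {a \<in> A. \<kappa> a = x}) $ n = (\<Sum>x\<le>n. \<Sum>a\<in>{a \<in> {a \<in> A. w a = n}. \<kappa> a = x}. \<sigma> a)"
    unfolding qsum_nth gf_nth by simp
  also have "\<dots> = (\<Sum>a\<in>{a \<in> A. w a = n}. \<sigma> a)"
    by (rule sum.group) (use assms in \<open>auto simp: finite_fibres_def\<close>)
  finally show "gf \<sigma> w A $ n = qsum (\<lambda>x. gf \<sigma> w {a \<in> A. \<kappa> a = x}) $ n" by (simp add: gf_nth)
qed

lemma gf_sum:
  assumes "finite_fibres w A" "\<And>a. a \<in> A \<Longrightarrow> \<kappa> a < (l :: nat)"
  shows "gf \<sigma> w A = (\<Sum>x<l. gf \<sigma> w {a \<in> A. \<kappa> a = x})"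
proof (rule fps_ext)
  fix n
  have "{a \<in> {a \<in> A. \<kappa> a = x}. w a = n} = {a \<in> {a \<in> A. w a = n}. \<kappa> a = x}" for x by auto
  then have "(\<Sum>x<l. gf \<sigma> w {a \<in> A. \<kappa> a = x}) $ n = (\<Sum>x<l. \<Sum>a\<in>{a \<in> {a \<in> A. w a = n}. \<kappa> a = x}. \<sigma> a)"
    unfolding fps_sum_nth gf_nth by simp
  also have "\<dots> = (\<Sum>a\<in>{a \<in> A. w a = n}. \<sigma> a)"
    by (rule sum.group) (use assms in \<open>auto simp: finite_fibres_def\<close>)
  finally show "gf \<sigma> w A $ n = (\<Sum>x<l. gf \<sigma> w {a \<in> A. \<kappa> a = x}) $ n" by (simp add: gf_nth)
qed

section \<open>Families of lists with product generating functions\<close>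

definition nonincr :: "nat \<Rightarrow> nat list set" where
  "nonincr n = {xs. length xs = n \<and> sorted_wrt (\<ge>) xs}"

definition box :: "nat \<Rightarrow> nat \<Rightarrow> nat list set" where
  "box n a = {xs \<in> nonincr n. set xs \<subseteq> {..a}}"

definition parts_le :: "nat \<Rightarrow> nat list set" where
  "parts_le s = {xs. is_partition xs \<and> set xs \<subseteq> {..s}}"

definition decr_above :: "nat \<Rightarrow> nat list set" where
  "decr_above k = {xs. sorted_wrt (>) xs \<and> set xs \<subseteq> {k<..}}"

abbreviation one :: "'a \<Rightarrow> int" where "one \<equiv> \<lambda>_. 1"

lemma finite_fibres_nonincr: "finite_fibres sum_list (nonincr n)"
  unfolding finite_fibres_def
proof
  fix k
  have "{xs \<in> nonincr n. sum_list xs = k} \<subseteq> {xs. set xs \<subseteq> {..k} \<and> length xs = n}"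
    using member_le_sum_list by (fastforce simp: nonincr_def)
  then show "finite {xs \<in> nonincr n. sum_list xs = k}" by (rule finite_subset) (simp add: finite_lists_length_eq)
qed

lemma finite_fibres_box: "finite_fibres sum_list (box n a)"
  by (rule finite_fibres_subset[OF finite_fibres_nonincr[of n]]) (auto simp: box_def)

lemma finite_fibres_partition: "finite_fibres sum_list {xs. is_partition xs}"
  unfolding finite_fibres_def
proof
  fix n show "finite {a \<in> {xs. is_partition xs}. sum_list a = n}"
    by (rule finite_subset[OF _ finite_partitions_le[of n]]) auto
qed

lemma finite_fibres_parts_le: "finite_fibres sum_list (parts_le s)"
  by (rule finite_fibres_subset[OF finite_fibres_partition]) (auto simp: parts_le_def)

lemma decr_above_partition: "xs \<in> decr_above k \<Longrightarrow> is_partition xs"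
  by (auto simp: decr_above_def is_partition_def intro: sorted_wrt_mono_rel[of _ "(>)"])

lemma finite_fibres_decr_above: "finite_fibres sum_list (decr_above s)"
  by (rule finite_fibres_subset[OF finite_fibres_partition]) (auto dest: decr_above_partition)

lemma finite_fibres_nat: "h > 0 \<Longrightarrow> finite_fibres (\<lambda>i. h * i) UNIV"
  unfolding finite_fibres_def
proof
  fix n assume "h > 0"
  then have "{i \<in> UNIV. h * i = n} \<subseteq> {..n}" by auto
  then show "finite {i \<in> UNIV. h * i = n}" by (rule finite_subset) simp
qed

lemma gf_nat:
  assumes "h > 0"
  shows "gf one (\<lambda>i. h * i) UNIV = geom_series h"
proof (rule fps_ext)
  fix n
  have "{i \<in> UNIV. h * i = n} = (if h dvd n then {n div h} else {})" using assms by auto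
  then show "gf one (\<lambda>i. h * i) UNIV $ n = geom_series h $ n" by (simp add: gf_nth geom_series_def)
qed

lemma sum_list_map_add: "sum_list (map (\<lambda>y. y + k) xs) = length xs * k + sum_list (xs :: nat list)"
  by (induction xs) auto

lemma sum_list_map_Suc: "sum_list (map Suc xs) = length xs + sum_list xs"
  using sum_list_map_add[of 1 xs] by simp

lemma solve_affine: "g = a + x * g \<Longrightarrow> (1 - x) * g = (a :: 'a :: comm_ring_1)"
  unfolding left_diff_distrib mult_1 diff_eq_eq by assumption

lemma gf_image:
  "inj_on f A \<Longrightarrow> (\<And>a. a \<in> A \<Longrightarrow> w (f a) = k + w a) \<Longrightarrow> gf one w (f ` A) = q ^ k * gf one w A"
  unfolding gf_shift[symmetric] by (rule gf_bij[where f=f]) (auto simp: bij_betw_def)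

text \<open>Entries may be 0, so a list is a partition into at most n parts padded to length n.
  Either a final 0 is removed, or all entries are lowered by 1.\<close>

lemma gf_nonincr: "gf one sum_list (nonincr n) = inv_qpoch n"
proof (induction n)
  case 0
  have "{a \<in> nonincr 0. sum_list a = n} = (if n = 0 then {[]} else {})" for n by (auto simp: nonincr_def)
  then show ?case by (intro fps_ext) (simp add: gf_nth)
next
  case (Suc n)
  have eq: "nonincr (Suc n) = (\<lambda>xs. xs @ [0]) ` nonincr n \<union> map Suc ` nonincr (Suc n)"
  proof (intro equalityI subsetI)
    fix xs assume xs: "xs \<in> nonincr (Suc n)"
    show "xs \<in> (\<lambda>xs. xs @ [0]) ` nonincr n \<union> map Suc ` nonincr (Suc n)"
    proof (cases "0 \<in> set xs")
      case True
      from xs obtain ys y where ys: "xs = ys @ [y]" by (cases xs rule: rev_cases) (auto simp: nonincr_def)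
      with True xs have "y = 0" by (auto simp: nonincr_def sorted_wrt_append)
      then show ?thesis using xs ys by (auto simp: nonincr_def sorted_wrt_append)
    next
      case False
      then have "map Suc (map (\<lambda>y. y - 1) xs) = xs" by (induction xs) auto
      moreover have "sorted_wrt (\<ge>) (map (\<lambda>y. y - 1) xs)"
        unfolding sorted_wrt_map by (rule sorted_wrt_mono_rel[of _ "(\<ge>)"]) (use xs in \<open>auto simp: nonincr_def\<close>)
      then have "map (\<lambda>y. y - 1) xs \<in> nonincr (Suc n)" using xs by (simp add: nonincr_def)
      ultimately show ?thesis by (metis UnI2 imageI)
    qed
  qed (auto simp: nonincr_def sorted_wrt_append sorted_wrt_map)
  have sub: "(\<lambda>xs. xs @ [0]) ` nonincr n \<subseteq> nonincr (Suc n)" "map Suc ` nonincr (Suc n) \<subseteq> nonincr (Suc n)"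
    using eq by blast+
  have "gf one sum_list (nonincr (Suc n)) = gf one sum_list ((\<lambda>xs. xs @ [0]) ` nonincr n) + gf one sum_list (map Suc ` nonincr (Suc n))"
  proof (subst eq, rule gf_Un)
    have "0 \<in> set xs" if "xs \<in> (\<lambda>xs. xs @ [0]) ` nonincr n" for xs using that by auto
    moreover have "0 \<notin> set xs" if "xs \<in> map Suc ` nonincr (Suc n)" for xs using that by auto
    ultimately show "(\<lambda>xs. xs @ [0]) ` nonincr n \<inter> map Suc ` nonincr (Suc n) = {}" by blast
  qed (rule finite_fibres_subset[OF finite_fibres_nonincr sub(1)], rule finite_fibres_subset[OF finite_fibres_nonincr sub(2)])
  also have "gf one sum_list ((\<lambda>xs. xs @ [0]) ` nonincr n) = q ^ 0 * gf one sum_list (nonincr n)"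
    by (rule gf_image) (auto simp: inj_on_def)
  also have "gf one sum_list (map Suc ` nonincr (Suc n)) = q ^ Suc n * gf one sum_list (nonincr (Suc n))"
    by (rule gf_image) (auto simp: sum_list_map_Suc nonincr_def inj_on_def)
  finally have "gf one sum_list (nonincr (Suc n)) = inv_qpoch n + q ^ Suc n * gf one sum_list (nonincr (Suc n))"
    unfolding Suc power_0 mult_1 .
  then have "(1 - q ^ Suc n) * gf one sum_list (nonincr (Suc n)) = inv_qpoch n" by (rule solve_affine)
  then show ?case unfolding inv_qpoch_rec[of n] by (rule q_pow_cancel[rotated]) simp
qed

lemma parts_le_0: "parts_le 0 = {[]}"
proof -
  have 1: "xs = []" if "xs \<in> parts_le 0" for xs
  proof (rule ccontr)
    assume "xs \<noteq> []"
    then have "hd xs \<in> set xs" by simp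
    moreover have "0 \<notin> set xs" "set xs \<subseteq> {..0}" using that by (simp_all add: parts_le_def is_partition_def)
    ultimately show False by (metis atMost_iff le_zero_eq subsetD)
  qed
  have 2: "[] \<in> parts_le 0" by (simp add: parts_le_def is_partition_def)
  show ?thesis using 1 2 by blast
qed

text \<open>Conjugate to \<open>gf_nonincr\<close>: the part n + 1 is absent, or one copy of it is
  removed.\<close>

lemma gf_parts_le: "gf one sum_list (parts_le n) = inv_qpoch n"
proof (induction n)
  case 0
  have "{a \<in> parts_le 0. sum_list a = n} = (if n = 0 then {[]} else {})" for n
    unfolding parts_le_0 by auto
  then show ?case by (intro fps_ext) (simp add: gf_nth)
next
  case (Suc n)
  have eq: "parts_le (Suc n) = parts_le n \<union> Cons (Suc n) ` parts_le (Suc n)"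
  proof (intro equalityI subsetI)
    fix xs assume xs: "xs \<in> parts_le (Suc n)"
    show "xs \<in> parts_le n \<union> Cons (Suc n) ` parts_le (Suc n)"
    proof (cases "Suc n \<in> set xs")
      case True
      then obtain y ys where ys: "xs = y # ys" by (cases xs) auto
      with True xs have "y = Suc n" by (auto simp: parts_le_def is_partition_def)
      then show ?thesis using xs ys by (auto simp: parts_le_def is_partition_def)
    next
      case False
      then have "set xs \<subseteq> {..n}" using xs unfolding parts_le_def atMost_Suc by blast
      then show ?thesis using xs by (auto simp: parts_le_def)
    qed
  qed (auto simp: parts_le_def is_partition_def)
  have sub: "parts_le n \<subseteq> parts_le (Suc n)" "Cons (Suc n) ` parts_le (Suc n) \<subseteq> parts_le (Suc n)"
    using eq by blast+
  have "gf one sum_list (parts_le (Suc n)) = gf one sum_list (parts_le n) + gf one sum_list (Cons (Suc n) ` parts_le (Suc n))"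
  proof (subst eq, rule gf_Un)
    show "parts_le n \<inter> Cons (Suc n) ` parts_le (Suc n) = {}" by (auto simp: parts_le_def)
  qed (rule finite_fibres_parts_le, rule finite_fibres_subset[OF finite_fibres_parts_le sub(2)])
  also have "gf one sum_list (Cons (Suc n) ` parts_le (Suc n)) = q ^ Suc n * gf one sum_list (parts_le (Suc n))"
    by (rule gf_image) auto
  finally have "gf one sum_list (parts_le (Suc n)) = inv_qpoch n + q ^ Suc n * gf one sum_list (parts_le (Suc n))"
    unfolding Suc power_0 mult_1 .
  then have "(1 - q ^ Suc n) * gf one sum_list (parts_le (Suc n)) = inv_qpoch n" by (rule solve_affine)
  then show ?case unfolding inv_qpoch_rec[of n] by (rule q_pow_cancel[rotated]) simp
qed

lemma box_0: "box n 0 = {replicate n 0}"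
proof -
  have "sorted_wrt (\<ge>) (replicate n (0::nat))" by (induction n) auto
  then have "replicate n 0 \<in> box n 0" by (auto simp: box_def nonincr_def)
  moreover have "xs = replicate n 0" if "xs \<in> box n 0" for xs
    using that by (intro replicate_eqI) (auto simp: box_def nonincr_def)
  ultimately show ?thesis by blast
qed

text \<open>The bound a is not attained, or a first entry a is removed. One case lowers a, the other
  n, hence the induction on n + a.\<close>

lemma gf_box: "gf one sum_list (box n a) = qbinom (n + a) n"
proof (induction "n + a" arbitrary: n a rule: less_induct)
  case less
  consider "n = 0" | "a = 0" | m b where "n = Suc m" "a = Suc b" by (cases n; cases a) auto
  then show ?case
  proof cases
    case 1
    have "{x \<in> box 0 a. sum_list x = k} = (if k = 0 then {[]} else {})" for k by (auto simp: box_def nonincr_def)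
    then show ?thesis unfolding 1 by (intro fps_ext) (simp add: gf_nth)
  next
    case 2
    have "{x \<in> box n 0. sum_list x = k} = (if k = 0 then {replicate n 0} else {})" for k
      unfolding box_0 by (auto simp: sum_list_replicate)
    then show ?thesis unfolding 2 by (intro fps_ext) (simp add: gf_nth)
  next
    case 3
    have eq: "box n a = box n b \<union> Cons a ` box m a"
    proof (intro equalityI subsetI)
      fix xs assume xs: "xs \<in> box n a"
      show "xs \<in> box n b \<union> Cons a ` box m a"
      proof (cases "a \<in> set xs")
        case True
        then obtain y ys where ys: "xs = y # ys" by (cases xs) auto
        with True xs have "y = a" by (auto simp: box_def nonincr_def)
        then show ?thesis using xs ys by (auto simp: box_def nonincr_def 3)
      next
        case False
        then have "set xs \<subseteq> {..b}" using xs unfolding box_def 3(2) atMost_Suc by blast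
        then show ?thesis using xs by (auto simp: box_def)
      qed
    qed (auto simp: box_def nonincr_def 3)
    have "gf one sum_list (box n a) = gf one sum_list (box n b) + gf one sum_list (Cons a ` box m a)"
      unfolding eq
    proof (rule gf_Un)
      show "finite_fibres sum_list (Cons a ` box m a)" by (rule finite_fibres_subset[OF finite_fibres_box[of n a]]) (use eq in blast)
    qed (auto simp: finite_fibres_box, auto simp: box_def 3)
    also have "gf one sum_list (Cons a ` box m a) = q ^ a * gf one sum_list (box m a)"
      by (rule gf_image) auto
    also have "gf one sum_list (box n b) = qbinom (n + b) n" using less[of n b] by (simp add: 3)
    also have "gf one sum_list (box m a) = qbinom (m + a) m" using less[of m a] by (simp add: 3)
    finally show ?thesis using qbinom_Suc_Suc'[of m "m + a"] by (simp add: 3 add.commute del: power_Suc)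
  qed
qed

text \<open>The recursion leads from k to k + 1. Coefficient n is settled for k \<ge> n, where only
  the empty list can count, and is carried down to smaller k by induction on j - k.\<close>

lemma gf_decr_above: "gf (\<lambda>xs. (-1) ^ length xs) sum_list (decr_above k) = euler_tail k"
proof -
  let ?s = "\<lambda>xs::nat list. (-1) ^ length xs :: int"
  let ?G = "\<lambda>k. gf ?s sum_list (decr_above k)"
  have rec: "?G k = (1 - q ^ Suc k) * ?G (Suc k)" for k
  proof -
    let ?f = "\<lambda>xs. xs @ [Suc k]"
    have eq: "decr_above k = decr_above (Suc k) \<union> ?f ` decr_above (Suc k)"
    proof (intro equalityI subsetI)
      fix xs assume xs: "xs \<in> decr_above k"
      show "xs \<in> decr_above (Suc k) \<union> ?f ` decr_above (Suc k)"
      proof (cases "Suc k \<in> set xs")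
        case True
        then obtain y ys where ys: "xs = ys @ [y]" by (cases xs rule: rev_cases) auto
        have "y = Suc k"
        proof (rule ccontr)
          assume "y \<noteq> Suc k"
          then have "Suc k > y" using True xs by (auto simp: ys decr_above_def sorted_wrt_append)
          then show False using xs by (auto simp: ys decr_above_def)
        qed
        then show ?thesis using xs ys by (auto simp: decr_above_def sorted_wrt_append)
      next
        case False
        then have "set xs \<subseteq> {Suc k<..}" using xs unfolding decr_above_def by (auto simp: subset_iff intro: Suc_lessI)
        then show ?thesis using xs by (auto simp: decr_above_def)
      qed
    qed (auto simp: decr_above_def sorted_wrt_append)
    have "?G k = ?G (Suc k) + gf ?s sum_list (?f ` decr_above (Suc k))"
    proof (subst eq, rule gf_Un)
      show "finite_fibres sum_list (?f ` decr_above (Suc k))" by (rule finite_fibres_subset[OF finite_fibres_decr_above[of k]]) (use eq in blast)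
      show "decr_above (Suc k) \<inter> ?f ` decr_above (Suc k) = {}" by (auto simp: decr_above_def)
    qed (rule finite_fibres_decr_above)
    also have "gf ?s sum_list (?f ` decr_above (Suc k)) = gf (\<lambda>xs. - ?s xs) (\<lambda>xs. Suc k + sum_list xs) (decr_above (Suc k))"
      by (rule gf_bij[where f="?f"]) (auto simp: bij_betw_def inj_on_def)
    also have "\<dots> = q ^ Suc k * - ?G (Suc k)"
      unfolding gf_shift by (rule arg_cong[of _ _ "\<lambda>x. q ^ Suc k * x"]) (rule fps_ext, simp add: gf_nth sum_negf)
    finally show ?thesis by (simp add: algebra_simps)
  qed
  have lim: "?G k $ n = 1 $ n" if "n \<le> k" for n k
  proof -
    have nil: "xs = []" if "xs \<in> decr_above k" "sum_list xs = n" for xs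
      using that \<open>n \<le> k\<close> by (cases xs) (auto simp: decr_above_def)
    show ?thesis
    proof (cases "n = 0")
      case True
      have "[] \<in> decr_above k" by (simp add: decr_above_def)
      with nil True have "{xs \<in> decr_above k. sum_list xs = n} = {[]}" by auto
      then show ?thesis by (simp add: gf_nth True)
    next
      case False
      with nil have "{xs \<in> decr_above k. sum_list xs = n} = {}" by force
      then show ?thesis unfolding gf_nth by (simp only: sum.empty fps_one_nth False if_False)
    qed
  qed
  have "?G k $ n = euler_tail k $ n" if "n \<le> j" for n j k
    using that
  proof (induction "j - k" arbitrary: k n)
    case 0
    then show ?case by (simp add: lim euler_tail_limit)
  next
    case (Suc x)
    then have IH: "?G (Suc k) $ i = euler_tail (Suc k) $ i" if "i \<le> n" for i using that by simp
    show ?case unfolding rec[of k] euler_tail_rec[of k] by (intro nth_mult_cong IH refl)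
  qed
  then show ?thesis by (intro fps_ext) blast
qed

subsection \<open>S-partitions\<close>

definition S_class :: "nat \<Rightarrow> nat \<Rightarrow> nat \<Rightarrow> partition_triple set" where
  "S_class m c i = {(p1, p2, p3) \<in> S_partitions. length p3 = c \<and> length p2 = c + m \<and> last p1 = Suc i}"

lemma smallest_part_le_iff:
  assumes "sorted_wrt (\<ge>) p1" "p1 \<noteq> []"
  shows "smallest_part p1 \<le> smallest_part p2 \<longleftrightarrow> (\<forall>x\<in>set p2. last p1 \<le> x)"
proof -
  have "last p1 \<le> x" if "x \<in> set p1" for x
    using assms that by (cases p1 rule: rev_cases) (auto simp: sorted_wrt_append)
  then have "smallest_part p1 = enat (last p1)"
    unfolding smallest_part_def using assms(2)
    by (intro antisym INF_greatest INF_lower2[of "last p1"]) auto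
  then show ?thesis unfolding smallest_part_def le_INF_iff by simp
qed

lemma distinct_partition_iff:
  "is_distinct_partition p \<and> p \<noteq> [] \<and> last p = Suc i \<longleftrightarrow> (\<exists>xs\<in>decr_above (Suc i). p = xs @ [Suc i])"
proof -
  have "sorted_wrt (\<ge>) p \<and> distinct p \<longleftrightarrow> sorted_wrt (>) p" for p :: "nat list"
    by (induction p) (auto simp: le_less)
  then have "is_distinct_partition p \<longleftrightarrow> sorted_wrt (>) p \<and> 0 \<notin> set p"
    by (auto simp: is_distinct_partition_def is_partition_def)
  then show ?thesis
    by (cases p rule: rev_cases) (auto simp: decr_above_def sorted_wrt_append)
qed

lemma ge_partition_iff:
  "is_partition p \<and> length p = n \<and> (\<forall>x\<in>set p. Suc i \<le> x) \<longleftrightarrow> (\<exists>xs\<in>nonincr n. p = map (\<lambda>y. y + Suc i) xs)"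
proof
  assume p: "is_partition p \<and> length p = n \<and> (\<forall>x\<in>set p. Suc i \<le> x)"
  let ?xs = "map (\<lambda>y. y - Suc i) p"
  have "map (\<lambda>y. y + Suc i) ?xs = p" unfolding map_map by (rule map_idI) (use p in auto)
  moreover have "sorted_wrt (\<ge>) ?xs"
    unfolding sorted_wrt_map by (rule sorted_wrt_mono_rel[of _ "(\<ge>)"]) (use p in \<open>auto simp: is_partition_def\<close>)
  then have "?xs \<in> nonincr n" using p by (simp add: nonincr_def)
  ultimately show "\<exists>xs\<in>nonincr n. p = map (\<lambda>y. y + Suc i) xs" by metis
next
  assume "\<exists>xs\<in>nonincr n. p = map (\<lambda>y. y + Suc i) xs"
  then show "is_partition p \<and> length p = n \<and> (\<forall>x\<in>set p. Suc i \<le> x)"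
    by (auto simp: nonincr_def is_partition_def sorted_wrt_map)
qed

lemma S_class_bij:
  "bij_betw (\<lambda>(xs, ys, zs). (xs @ [Suc i], map (\<lambda>y. y + Suc i) ys, map (\<lambda>y. y + Suc i) zs))
     (decr_above (Suc i) \<times> nonincr (c + m) \<times> nonincr c) (S_class m c i)"
  (is "bij_betw ?f ?A _")
proof -
  have "inj_on ?f ?A" by (auto simp: inj_on_def)
  moreover have "p \<in> S_class m c i \<longleftrightarrow> p \<in> ?f ` ?A" for p
  proof -
    obtain p1 p2 p3 where p: "p = (p1, p2, p3)" by (metis prod_cases3)
    have "p \<in> S_class m c i \<longleftrightarrow> (is_distinct_partition p1 \<and> p1 \<noteq> [] \<and> last p1 = Suc i)
       \<and> (is_partition p2 \<and> length p2 = c + m \<and> (\<forall>x\<in>set p2. Suc i \<le> x))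
       \<and> (is_partition p3 \<and> length p3 = c \<and> (\<forall>x\<in>set p3. Suc i \<le> x))"
      using smallest_part_le_iff[of p1 p2] smallest_part_le_iff[of p1 p3]
      by (auto simp: p S_class_def S_partitions_def is_distinct_partition_def is_partition_def)
    also have "\<dots> \<longleftrightarrow> p \<in> ?f ` ?A"
      unfolding distinct_partition_iff ge_partition_iff p by (auto simp: image_iff Bex_def)
    finally show ?thesis .
  qed
  ultimately show ?thesis unfolding bij_betw_def by blast
qed

text \<open>The exponent takes i + 1 once for the smallest part of the first component and once for
  each of the 2c + m parts of the others. The remaining list has length
  \<open>length p1 - 1\<close>, which gives the sign.\<close>

lemma gf_S_class: "gf S_sign S_weight (S_class m c i)
   = q ^ (Suc i * Suc (2 * c + m)) * euler_tail (Suc i) * (inv_qpoch c * inv_qpoch (c + m))"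
proof -
  have "gf S_sign S_weight (S_class m c i)
    = gf (\<lambda>(xs, yz). (-1) ^ length xs * (case yz of (ys, zs) \<Rightarrow> one ys * one zs))
        (\<lambda>a. Suc i * Suc (2 * c + m) + (case a of (xs, yz) \<Rightarrow> sum_list xs + (case yz of (ys, zs) \<Rightarrow> sum_list ys + sum_list zs)))
        (decr_above (Suc i) \<times> nonincr (c + m) \<times> nonincr c)"
    by (rule gf_bij[OF S_class_bij]) (auto simp: sum_list_map_add nonincr_def algebra_simps simp del: add_Suc_right)
  also have "\<dots> = q ^ (Suc i * Suc (2 * c + m)) * (euler_tail (Suc i) * (inv_qpoch (c + m) * inv_qpoch c))"
    unfolding gf_shift
    by (simp only: gf_times finite_fibres_times finite_fibres_decr_above finite_fibres_nonincr gf_decr_above gf_nonincr)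
  finally show ?thesis by (simp only: mult_ac)
qed

lemma finite_fibres_S: "finite_fibres S_weight {\<pi> \<in> S_partitions. S_crank \<pi> = m}"
  unfolding finite_fibres_def
proof
  fix n
  have "{a \<in> {\<pi> \<in> S_partitions. S_crank \<pi> = m}. S_weight a = n} = {\<pi> \<in> S_partitions. S_weight \<pi> = n \<and> S_crank \<pi> = m}"
    by auto
  then show "finite {a \<in> {\<pi> \<in> S_partitions. S_crank \<pi> = m}. S_weight a = n}"
    using finite_S_partitions[of n m] by simp
qed

lemma last_le_sum_list: "xs \<noteq> [] \<Longrightarrow> last xs \<le> sum_list (xs :: nat list)"
  by (rule member_le_sum_list) simp_all

lemma N_S_spt_gf: "N_S (int m) n = spt_gf m $ n"
proof -
  let ?A = "{\<pi> \<in> S_partitions. S_crank \<pi> = int m}"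
  let ?c = "\<lambda>(p1, p2, p3). length p3 :: nat" and ?i = "\<lambda>(p1, p2, p3). last p1 - 1 :: nat"
  have fin: "finite_fibres S_weight {a \<in> ?A. ?c a = c}" for c by (rule finite_fibres_subset[OF finite_fibres_S[of "int m"]]) auto
  have S_class: "{a \<in> {a \<in> ?A. ?c a = c}. ?i a = i} = S_class m c i" for c i
  proof -
    have "last p1 \<noteq> 0" if "(p1, p2, p3) \<in> S_partitions" for p1 p2 p3
    proof -
      have "0 \<notin> set p1" "p1 \<noteq> []"
        using that by (simp_all add: S_partitions_def is_distinct_partition_def is_partition_def)
      then show ?thesis by (metis last_in_set)
    qed
    then show ?thesis by (fastforce simp: S_class_def)
  qed
  have "N_S (int m) n = gf S_sign S_weight ?A $ n"
    unfolding N_S_def gf_nth by (rule sum.cong) auto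
  also have "gf S_sign S_weight ?A = qsum (\<lambda>c. gf S_sign S_weight {a \<in> ?A. ?c a = c})"
  proof (rule gf_qsum[OF finite_fibres_S])
    fix a assume "a \<in> ?A"
    then show "?c a \<le> S_weight a"
      by (cases a) (auto simp: S_partitions_def intro: le_trans[OF is_partition_length_le] trans_le_add2)
  qed
  also have "\<dots> = qsum (\<lambda>c. qsum (\<lambda>i. gf S_sign S_weight (S_class m c i)))"
  proof (rule qsum_cong)
    fix c
    show "gf S_sign S_weight {a \<in> ?A. ?c a = c} = qsum (\<lambda>i. gf S_sign S_weight (S_class m c i))"
      unfolding S_class[symmetric]
    proof (rule gf_qsum[OF fin])
      fix a assume "a \<in> {a \<in> ?A. ?c a = c}"
      then show "?i a \<le> S_weight a"
        using last_le_sum_list[of "fst a"] by (cases a) (auto simp: S_partitions_def)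
    qed
  qed
  also have "\<dots> = spt_gf m"
    unfolding spt_gf_def
  proof (rule qsum_cong)
    fix c
    \<comment> \<open>The sum over the smallest part i + 1 is \<open>qsum_euler_tail\<close> with a
      = 2c + m.\<close>
    have "qsummable (\<lambda>i. q ^ (Suc i * Suc (2 * c + m)) * euler_tail (Suc i))" by (rule qsummable_q_pow) simp
    then show "qsum (\<lambda>i. gf S_sign S_weight (S_class m c i)) = (qpoch (2 * c + m) - euler) * (inv_qpoch c * inv_qpoch (c + m))"
      unfolding gf_S_class qsum_euler_tail[symmetric] by (simp only: qsum_mult mult.commute[of _ "inv_qpoch c * inv_qpoch (c + m)"])
  qed
  finally show ?thesis .
qed

lemma N_S_uminus: "N_S (- m) n = N_S m n"
  unfolding N_S_def
  by (rule sum.reindex_bij_witness[where i="\<lambda>(p1, p2, p3). (p1, p3, p2)" and j="\<lambda>(p1, p2, p3). (p1, p3, p2)"])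
    (auto simp: S_partitions_def)

subsection \<open>Doubly marked partitions\<close>

lemma conj_part_append:
  assumes "\<forall>x\<in>set xs. s \<le> x" "\<forall>x\<in>set ys. x < s"
  shows "conj_part (xs @ ys) s = length xs"
proof -
  have "filter (\<lambda>p. s \<le> p) xs = xs" "filter (\<lambda>p. s \<le> p) ys = []"
    using assms by (auto simp: filter_id_conv filter_empty_conv)
  then show ?thesis by (simp add: conj_part_def)
qed

lemma conj_part_split:
  assumes "sorted_wrt (\<ge>) lam"
  shows "\<forall>x\<in>set (take (conj_part lam s) lam). s \<le> x" "\<forall>x\<in>set (drop (conj_part lam s) lam). x < s"
proof -
  have "(\<forall>x\<in>set (take (conj_part lam s) lam). s \<le> x) \<and> (\<forall>x\<in>set (drop (conj_part lam s) lam). x < s)"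
    using assms
  proof (induction lam)
    case (Cons x xs)
    show ?case
    proof (cases "s \<le> x")
      case True
      then have "conj_part (x # xs) s = Suc (conj_part xs s)" by (simp add: conj_part_def)
      then show ?thesis using Cons True by simp
    next
      case False
      then have lt: "\<forall>y\<in>set (x # xs). y < s" using Cons.prems by auto
      then have "conj_part (x # xs) s = 0" using conj_part_append[of "[]" s "x # xs"] by simp
      then show ?thesis using lt by simp
    qed
  qed simp
  then show "\<forall>x\<in>set (take (conj_part lam s) lam). s \<le> x" "\<forall>x\<in>set (drop (conj_part lam s) lam). x < s"
    by blast+
qed

lemma conj_part_le_length: "conj_part lam s \<le> length lam"
  by (simp add: conj_part_def)

text \<open>As the rows decrease, both conditions say that row s has length at least s.\<close>

lemma le_durfee_iff:
  assumes "sorted_wrt (\<ge>) lam" "s > 0"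
  shows "s \<le> durfee lam \<longleftrightarrow> s \<le> conj_part lam s"
proof -
  let ?D = "{d. {1..d} \<times> {1..d} \<subseteq> young_diagram lam}"
  have iff: "d \<in> ?D \<longleftrightarrow> d \<le> conj_part lam d" if "d > 0" for d
  proof
    assume "d \<in> ?D"
    moreover have "(d, d) \<in> {1..d} \<times> {1..d}" using that by simp
    ultimately have "(d, d) \<in> young_diagram lam" by blast
    then have d: "d \<le> length lam" "d \<le> lam ! (d - 1)" using that by (auto simp: young_diagram_def Defs.part_def split: if_splits)
    show "d \<le> conj_part lam d"
    proof (rule ccontr)
      assume "\<not> d \<le> conj_part lam d"
      then have "lam ! (d - 1) \<in> set (drop (conj_part lam d) lam)"
        using d(1) that by (auto simp: in_set_conv_nth intro!: exI[of _ "d - 1 - conj_part lam d"])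
      then show False using conj_part_split(2)[OF assms(1), of d] d(2) by auto
    qed
  next
    assume d: "d \<le> conj_part lam d"
    have "d \<le> lam ! (i - 1)" if "1 \<le> i" "i \<le> d" for i
    proof -
      have "lam ! (i - 1) \<in> set (take (conj_part lam d) lam)"
        using that d conj_part_le_length[of lam d] by (auto simp: in_set_conv_nth intro!: exI[of _ "i - 1"])
      then show ?thesis using conj_part_split(1)[OF assms(1), of d] by blast
    qed
    then show "d \<in> ?D"
      using d conj_part_le_length[of lam d] by (fastforce simp: young_diagram_def Defs.part_def)
  qed
  have zero: "0 \<in> ?D" by simp
  then have max: "durfee lam \<in> ?D"
    unfolding durfee_def using finite_squares_in_diagram[of lam] by (intro Max_in) blast+
  show ?thesis
  proof
    assume s: "s \<le> durfee lam"
    then have "{1..s} \<times> {1..s} \<subseteq> {1..durfee lam} \<times> {1..durfee lam}" by auto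
    with max have "s \<in> ?D" by blast
    then show "s \<le> conj_part lam s" using iff assms(2) by blast
  next
    assume "s \<le> conj_part lam s"
    then have "s \<in> ?D" using iff assms(2) by blast
    then show "s \<le> durfee lam" unfolding durfee_def by (intro Max_ge finite_squares_in_diagram)
  qed
qed

section \<open>Decomposition of doubly marked partitions by g, l and s\<close>

definition dm_set :: "(nat list \<times> nat \<times> nat) set" where
  "dm_set = {(lam, s, t). is_partition lam \<and> 1 \<le> s \<and> s \<le> t \<and> s \<le> conj_part lam s \<and> conj_part lam t = conj_part lam s}"

definition dm_weight :: "nat list \<times> nat \<times> nat \<Rightarrow> nat" where
  "dm_weight = (\<lambda>(lam, s, t). sum_list lam)"

definition dm_g :: "nat list \<times> nat \<times> nat \<Rightarrow> nat" where
  "dm_g = (\<lambda>(lam, s, t). conj_part lam s - s + 1)"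

definition dm_l :: "nat list \<times> nat \<times> nat \<Rightarrow> nat" where
  "dm_l = (\<lambda>(lam, s, t). part lam (conj_part lam s - s + 1) - t + s)"

text \<open>The bound on t is recovered from \<open>conj_part lam t \<ge> s > 0\<close>: a column of
  positive length meets the first row.\<close>

lemma doubly_marked_partitions_eq: "doubly_marked_partitions n = {x \<in> dm_set. dm_weight x = n}"
proof -
  have "(lam, s, t) \<in> doubly_marked_partitions n \<longleftrightarrow> (lam, s, t) \<in> dm_set \<and> sum_list lam = n" for lam s t
  proof (cases "is_partition lam \<and> 1 \<le> s \<and> s \<le> conj_part lam s \<and> conj_part lam t = conj_part lam s")
    case True
    then have sorted: "sorted_wrt (\<ge>) lam" by (simp add: is_partition_def)
    have "lam \<noteq> []" using True by (auto simp: conj_part_def)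
    then obtain x xs where lam: "lam = x # xs" by (cases lam) auto
    have "0 < conj_part lam t" using True by simp
    then have "t \<le> x" using conj_part_split(1)[OF sorted, of t] by (cases "conj_part lam t") (auto simp: lam)
    then have "t \<le> part lam 1" by (simp add: Defs.part_def lam)
    then show ?thesis
      using True le_durfee_iff[OF sorted, of s] by (auto simp: doubly_marked_partitions_def dm_set_def)
  next
    case False
    then show ?thesis
      using le_durfee_iff[of lam s] by (auto simp: doubly_marked_partitions_def dm_set_def is_partition_def)
  qed
  then show ?thesis by (auto simp: dm_weight_def)
qed

lemma finite_fibres_dm_set: "finite_fibres dm_weight dm_set"
  unfolding finite_fibres_def doubly_marked_partitions_eq[symmetric] using finite_doubly_marked_partitions by blast

text \<open>Row g is at or above row \<open>conj_part lam t\<close>, and all these rows have length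
  at least t. Hence the subtraction in \<open>dm_l\<close> is exact.\<close>

lemma dm_g_part:
  assumes "(lam, s, t) \<in> dm_set"
  shows "t \<le> part lam (dm_g (lam, s, t))" "dm_g (lam, s, t) \<le> length lam"
proof -
  let ?h = "conj_part lam s" and ?g = "dm_g (lam, s, t)"
  have *: "sorted_wrt (\<ge>) lam" "1 \<le> s" "s \<le> ?h" "conj_part lam t = ?h"
    using assms by (auto simp: dm_set_def is_partition_def)
  then have g: "1 \<le> ?g" "?g \<le> ?h" by (auto simp: dm_g_def)
  then show "?g \<le> length lam" using conj_part_le_length[of lam s] by simp
  have "lam ! (?g - 1) \<in> set (take ?h lam)"
    using g conj_part_le_length[of lam s] by (auto simp: in_set_conv_nth intro!: exI[of _ "?g - 1"])
  then have "t \<le> lam ! (?g - 1)" using conj_part_split(1)[OF *(1), of t] *(4) by auto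
  then show "t \<le> part lam ?g" using g \<open>?g \<le> length lam\<close> by (simp add: Defs.part_def)
qed

lemma dm_crank_eq:
  assumes "x \<in> dm_set"
  shows "dm_crank x = int (dm_g x) - int (dm_l x)"
proof -
  obtain lam s t where x: "x = (lam, s, t)" by (cases x)
  show ?thesis using dm_g_part(1)[of lam s t] assms
    by (simp add: x dm_g_def dm_l_def Let_def)
qed

lemma dm_g_le: "x \<in> dm_set \<Longrightarrow> dm_g x \<le> dm_weight x"
proof -
  assume "x \<in> dm_set"
  moreover obtain lam s t where x: "x = (lam, s, t)" by (cases x)
  ultimately have "dm_g x \<le> length lam" "is_partition lam" using dm_g_part(2)[of lam s t] by (auto simp: dm_set_def)
  then show ?thesis using is_partition_length_le[of lam] by (simp add: x dm_weight_def)
qed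

lemma dm_l_le: "x \<in> dm_set \<Longrightarrow> dm_l x \<le> dm_weight x"
proof -
  assume x': "x \<in> dm_set"
  obtain lam s t where x: "x = (lam, s, t)" by (cases x)
  let ?g = "dm_g x"
  have "part lam ?g \<in> set lam" using dm_g_part(2)[of lam s t] x' by (simp add: Defs.part_def x) (simp add: dm_g_def)
  then have "part lam ?g \<le> sum_list lam" by (rule member_le_sum_list) simp_all
  moreover have "dm_l x = part lam ?g - t + s" by (simp add: x dm_l_def dm_g_def)
  moreover have "t \<le> part lam ?g" "s \<le> t" using dm_g_part(1)[of lam s t] x' by (auto simp: x dm_set_def)
  ultimately show ?thesis by (simp add: x dm_weight_def)
qed

text \<open>
  The parts of \<open>\<lambda>\<close> above row \<open>g\<close> exceed \<open>\<lambda>\<^sub>g = l + i\<close> by \<open>A\<close>, those below it down to row \<open>\<lambda>'\<^sub>s\<close> exceed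
  \<open>t = s + i\<close> by \<open>B\<close>, and the parts below \<open>s = e + 1\<close> form \<open>T\<close>.
\<close>

definition dm_build where
  "dm_build g l e = (\<lambda>(i, A, B, T).
     (map (\<lambda>y. y + (l + i)) A @ (l + i) # map (\<lambda>y. y + (Suc e + i)) B @ T, Suc e, Suc e + i))"

definition dm_class :: "nat \<Rightarrow> nat \<Rightarrow> nat \<Rightarrow> (nat list \<times> nat \<times> nat) set" where
  "dm_class g l e = {x \<in> dm_set. dm_g x = Suc g \<and> dm_l x = l \<and> fst (snd x) = Suc e}"

lemma dm_build_in:
  assumes "e < l" "A \<in> nonincr g" "B \<in> box e (l - Suc e)" "T \<in> parts_le e"
  shows "dm_build g l e (i, A, B, T) \<in> dm_class g l e"
proof -
  let ?A = "map (\<lambda>y. y + (l + i)) A" and ?B = "map (\<lambda>y. y + (Suc e + i)) B"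
  let ?H = "?A @ (l + i) # ?B"
  let ?lam = "?H @ T" and ?s = "Suc e" and ?t = "Suc e + i"
  have len: "length A = g" "length B = e" using assms by (auto simp: nonincr_def box_def)
  have H: "\<forall>x\<in>set ?H. ?t \<le> x" using assms(1) by auto
  have T: "\<forall>x\<in>set T. x < ?s" using assms(4) by (auto simp: parts_le_def)
  have B: "\<forall>x\<in>set ?B. x \<le> l + i" using assms(1,3) by (auto simp: box_def)
  have "sorted_wrt (\<ge>) ?H"
    using assms(2,3) B H by (auto simp: nonincr_def box_def sorted_wrt_append sorted_wrt_map)
  then have "is_partition ?lam"
    using H T assms(4) by (fastforce simp: is_partition_def sorted_wrt_append parts_le_def)
  moreover have cs: "conj_part ?lam ?s = g + Suc e"
    using conj_part_append[of ?H ?s T] H T len by fastforce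
  moreover have "conj_part ?lam ?t = g + Suc e"
    using conj_part_append[of ?H ?t T] H T len by fastforce
  moreover have "part ?lam (Suc g) = l + i" by (simp add: Defs.part_def nth_append len)
  ultimately show ?thesis using assms(1)
    by (simp add: dm_class_def dm_set_def dm_build_def dm_g_def dm_l_def)
qed

lemma dm_build_surj:
  assumes "x \<in> dm_class g l e"
  shows "e < l" "\<exists>i A B T. A \<in> nonincr g \<and> B \<in> box e (l - Suc e) \<and> T \<in> parts_le e \<and> x = dm_build g l e (i, A, B, T)"
proof -
  obtain lam s t where x: "x = (lam, s, t)" by (cases x)
  have s: "s = Suc e" and dm_set: "(lam, s, t) \<in> dm_set" using assms by (auto simp: dm_class_def x)
  have p: "is_partition lam" "s \<le> t" "s \<le> conj_part lam s" "conj_part lam t = conj_part lam s"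
    using dm_set by (auto simp: dm_set_def)
  have sorted: "sorted_wrt (\<ge>) lam" using p(1) by (simp add: is_partition_def)
  define h where "h = conj_part lam s"
  have g: "dm_g x = Suc g" using assms by (simp add: dm_class_def)
  then have h: "h = g + Suc e" using p(3) by (simp add: x dm_g_def h_def s)
  have hl: "h \<le> length lam" by (simp add: h_def conj_part_le_length)
  obtain i where i: "t = Suc e + i" using p(2) s le_Suc_ex by blast
  define y where "y = lam ! g"
  have y: "part lam (Suc g) = y" using h hl by (simp add: Defs.part_def y_def)
  have ty: "t \<le> y" using dm_g_part(1)[OF dm_set] g y by (simp add: x)
  have "dm_l x = y - t + s" using y g by (simp add: x dm_l_def dm_g_def)
  then have l: "y = l + i" "e < l" using assms ty s i by (auto simp: dm_class_def)
  \<comment> \<open>As \<open>dm_g x = Suc g\<close>, the marked row is \<open>lam ! g\<close>: g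
    rows lie above it, and e = h - g - 1 rows follow it down to row h.\<close>
  define H where "H = take g lam"
  define K where "K = take e (drop (Suc g) lam)"
  define T where "T = drop h lam"
  have lam: "lam = H @ y # K @ T"
  proof -
    have "lam = H @ y # drop (Suc g) lam"
      unfolding H_def y_def using h hl by (intro id_take_nth_drop) simp
    moreover have "drop (Suc g) lam = K @ T"
      unfolding K_def T_def h by (metis append_take_drop_id drop_drop add_Suc_shift add.commute)
    ultimately show ?thesis by simp
  qed
  have len: "length H = g" "length K = e" using h hl by (auto simp: H_def K_def)
  have tk: "take h lam = H @ y # K" using lam len h by simp
  have HK: "\<forall>x\<in>set (H @ y # K). t \<le> x" using conj_part_split(1)[OF sorted, of t] p(4) tk h_def by simp
  have Ts: "\<forall>x\<in>set T. x < s" using conj_part_split(2)[OF sorted, of s] by (simp add: T_def h_def)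
  have so: "sorted_wrt (\<ge>) H" "\<forall>x\<in>set H. y \<le> x" "sorted_wrt (\<ge>) K" "\<forall>x\<in>set K. x \<le> y" "sorted_wrt (\<ge>) T"
    using sorted by (auto simp: lam sorted_wrt_append)
  define A where "A = map (\<lambda>z. z - y) H"
  define B where "B = map (\<lambda>z. z - t) K"
  have A: "map (\<lambda>z. z + y) A = H" "A \<in> nonincr g"
  proof -
    show "map (\<lambda>z. z + y) A = H" unfolding A_def map_map by (rule map_idI) (use so in auto)
    have "sorted_wrt (\<ge>) A" unfolding A_def sorted_wrt_map
      by (rule sorted_wrt_mono_rel[of _ "(\<ge>)"]) (use so in auto)
    then show "A \<in> nonincr g" by (simp add: nonincr_def A_def len)
  qed
  have B: "map (\<lambda>z. z + t) B = K" "B \<in> box e (l - Suc e)"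
  proof -
    show "map (\<lambda>z. z + t) B = K" unfolding B_def map_map by (rule map_idI) (use HK in auto)
    have "sorted_wrt (\<ge>) B" unfolding B_def sorted_wrt_map
      by (rule sorted_wrt_mono_rel[of _ "(\<ge>)"]) (use so in auto)
    \<comment> \<open>The width of the box is y - t = (l + i) - (e + 1 + i).\<close>
    moreover have "set B \<subseteq> {..l - Suc e}" unfolding B_def using so(4) l i by auto
    ultimately show "B \<in> box e (l - Suc e)" by (simp add: box_def nonincr_def B_def len)
  qed
  have "T \<in> parts_le e" using Ts so(5) p(1) by (auto simp: parts_le_def s is_partition_def lam)
  moreover have "x = dm_build g l e (i, A, B, T)"
    unfolding dm_build_def x by (simp add: lam A(1)[unfolded l(1)] B(1)[unfolded i] s i l(1) del: add_Suc add_Suc_right)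
  ultimately show "\<exists>i A B T. A \<in> nonincr g \<and> B \<in> box e (l - Suc e) \<and> T \<in> parts_le e \<and> x = dm_build g l e (i, A, B, T)"
    using A(2) B(2) by blast
  show "e < l" by (fact l)
qed

lemma dm_build_bij:
  assumes "e < l"
  shows "bij_betw (dm_build g l e) (UNIV \<times> nonincr g \<times> box e (l - Suc e) \<times> parts_le e) (dm_class g l e)"
proof (rule bij_betw_imageI)
  show "inj_on (dm_build g l e) (UNIV \<times> nonincr g \<times> box e (l - Suc e) \<times> parts_le e)"
  proof (rule inj_onI)
    fix a b :: "nat \<times> nat list \<times> nat list \<times> nat list"
    assume ab: "a \<in> UNIV \<times> nonincr g \<times> box e (l - Suc e) \<times> parts_le e" "b \<in> UNIV \<times> nonincr g \<times> box e (l - Suc e) \<times> parts_le e"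
      and eq: "dm_build g l e a = dm_build g l e b"
    obtain i A B T i' A' B' T' where a: "a = (i, A, B, T)" "b = (i', A', B', T')" by (cases a; cases b)
    have "length A = length A'" "length B = length B'" using ab by (simp_all add: a nonincr_def box_def)
    with eq have "i = i'" "T = T'" "map (\<lambda>y. y + (l + i)) A = map (\<lambda>y. y + (l + i)) A'"
      "map (\<lambda>y. y + (Suc e + i)) B = map (\<lambda>y. y + (Suc e + i)) B'"
      by (auto simp: a dm_build_def)
    then show "a = b" by (simp add: a inj_map_eq_map inj_on_def)
  qed
  show "dm_build g l e ` (UNIV \<times> nonincr g \<times> box e (l - Suc e) \<times> parts_le e) = dm_class g l e"
  proof (intro equalityI subsetI)
    fix x assume "x \<in> dm_class g l e"
    from dm_build_surj(2)[OF this]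
    show "x \<in> dm_build g l e ` (UNIV \<times> nonincr g \<times> box e (l - Suc e) \<times> parts_le e)" by blast
  qed (use dm_build_in[OF assms] in auto)
qed

text \<open>The first g + 1 rows carry l each and the next e rows e + 1 each. Raising i by one
  lengthens all e + g + 1 rows, whence the geometric series.\<close>

lemma gf_dm_class:
  assumes "e < l"
  shows "gf one dm_weight (dm_class g l e) = q ^ (Suc g * l) *
    (inv_qpoch g * (qbinom (l - 1) e * (q ^ (e * Suc e) * (inv_qpoch e * geom_series (Suc (e + g))))))"
proof -
  let ?w = "\<lambda>(i, ABT). Suc (e + g) * i + (case ABT of (A, BT) \<Rightarrow> sum_list A +
      (case BT of (B, T) \<Rightarrow> sum_list B + sum_list T))"
  have "gf one dm_weight (dm_class g l e)
    = gf one (\<lambda>a. (Suc g * l + e * Suc e) + ?w a) (UNIV \<times> nonincr g \<times> box e (l - Suc e) \<times> parts_le e)"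
  proof (rule gf_bij[OF dm_build_bij[OF assms]])
    fix a :: "nat \<times> nat list \<times> nat list \<times> nat list"
    assume a: "a \<in> UNIV \<times> nonincr g \<times> box e (l - Suc e) \<times> parts_le e"
    obtain i A B T where iABT: "a = (i, A, B, T)" by (cases a)
    with a have "length A = g" "length B = e" by (auto simp: nonincr_def box_def)
    then show "dm_weight (dm_build g l e a) = (Suc g * l + e * Suc e) + ?w a"
      unfolding iABT dm_build_def dm_weight_def prod.case sum_list_append sum_list.Cons sum_list_map_add
      by (simp add: algebra_simps)
  qed simp
  also have "\<dots> = q ^ (Suc g * l + e * Suc e) * gf (\<lambda>(i, ABT). one i * (case ABT of (A, BT) \<Rightarrow> one A *
      (case BT of (B, T) \<Rightarrow> one B * one T))) ?w (UNIV \<times> nonincr g \<times> box e (l - Suc e) \<times> parts_le e)"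
    unfolding gf_shift by (simp add: case_prod_unfold)
  also have "\<dots> = q ^ (Suc g * l + e * Suc e) * (geom_series (Suc (e + g)) * (inv_qpoch g * (qbinom (e + (l - Suc e)) e * inv_qpoch e)))"
    by (simp only: gf_times finite_fibres_times finite_fibres_nonincr finite_fibres_box finite_fibres_parts_le finite_fibres_nat gf_nat gf_nonincr gf_box gf_parts_le zero_less_Suc)
  also have "e + (l - Suc e) = l - 1" using assms by simp
  finally show ?thesis unfolding power_add by (simp only: mult_ac)
qed

lemma gf_dm_set_gl: "gf one dm_weight {x \<in> dm_set. dm_g x = Suc g \<and> dm_l x = l} = q ^ (Suc g * l) * dm_kernel g l"
proof -
  let ?A = "{x \<in> dm_set. dm_g x = Suc g \<and> dm_l x = l}" and ?e = "\<lambda>(lam, s, t). s - 1 :: nat"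
  have e: "{a \<in> ?A. ?e a = e} = dm_class g l e" for e by (auto simp: dm_class_def dm_set_def)
  have "gf one dm_weight ?A = (\<Sum>e<l. gf one dm_weight {a \<in> ?A. ?e a = e})"
  proof (rule gf_sum)
    show "finite_fibres dm_weight ?A" by (rule finite_fibres_subset[OF finite_fibres_dm_set]) auto
    fix a assume "a \<in> ?A"
    then have "a \<in> dm_class g l (?e a)" using e[of "?e a"] by auto
    then show "?e a < l" by (rule dm_build_surj)
  qed
  also have "\<dots> = (\<Sum>e<l. q ^ (Suc g * l) *
    (inv_qpoch g * (qbinom (l - 1) e * (q ^ (e * Suc e) * (inv_qpoch e * geom_series (Suc (e + g)))))))"
    unfolding e by (intro sum.cong refl gf_dm_class) simp
  finally show ?thesis unfolding dm_kernel_def sum_distrib_left .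
qed

section \<open>Assembly by spt-crank\<close>

lemma dm_l_pos: "x \<in> dm_set \<Longrightarrow> dm_l x > 0"
  by (auto simp: dm_set_def dm_l_def)

lemma dm_g_pos: "dm_g x > 0"
  by (cases x) (simp add: dm_g_def)

lemma card_dm_set:
  "int (card {x \<in> doubly_marked_partitions n. dm_crank x = m}) = gf one dm_weight {x \<in> dm_set. dm_crank x = m} $ n"
proof -
  have "{x \<in> {x \<in> dm_set. dm_weight x = n}. dm_crank x = m} = {x \<in> {x \<in> dm_set. dm_crank x = m}. dm_weight x = n}" by blast
  then show ?thesis unfolding gf_nth doubly_marked_partitions_eq by simp
qed

text \<open>The set is graded by the smaller of g and l, here l; the other is fixed by g - l =
  m.\<close>

lemma dm_set_dm_gf_pos: "gf one dm_weight {x \<in> dm_set. dm_crank x = int m} = dm_gf_pos m"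
proof -
  let ?A = "{x \<in> dm_set. dm_crank x = int m}"
  have "{a \<in> ?A. dm_l a - 1 = x} = {y \<in> dm_set. dm_g y = Suc (x + m) \<and> dm_l y = Suc x}" for x
    using dm_crank_eq dm_l_pos by fastforce
  moreover have "gf one dm_weight ?A = qsum (\<lambda>x. gf one dm_weight {a \<in> ?A. dm_l a - 1 = x})"
  proof (rule gf_qsum)
    show "finite_fibres dm_weight ?A" by (rule finite_fibres_subset[OF finite_fibres_dm_set]) auto
  qed (use dm_l_le in fastforce)
  ultimately show ?thesis by (simp only: gf_dm_set_gl dm_gf_pos_def add_Suc)
qed

lemma dm_set_dm_gf_neg: "gf one dm_weight {x \<in> dm_set. dm_crank x = - int m} = dm_gf_neg m"
proof -
  let ?A = "{x \<in> dm_set. dm_crank x = - int m}"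
  have "{a \<in> ?A. dm_g a - 1 = x} = {y \<in> dm_set. dm_g y = Suc x \<and> dm_l y = Suc x + m}" for x
    using dm_crank_eq dm_g_pos by fastforce
  moreover have "gf one dm_weight ?A = qsum (\<lambda>x. gf one dm_weight {a \<in> ?A. dm_g a - 1 = x})"
  proof (rule gf_qsum)
    show "finite_fibres dm_weight ?A" by (rule finite_fibres_subset[OF finite_fibres_dm_set]) auto
  qed (use dm_g_le in fastforce)
  ultimately show ?thesis by (simp only: gf_dm_set_gl dm_gf_neg_def)
qed

theorem theorem2p3:
  fixes m :: int and n :: nat
  assumes "n > 0"
  shows "N_S m n = int (card {x \<in> doubly_marked_partitions n. dm_crank x = m})"
proof (cases "m \<ge> 0")
  case True
  then obtain k where "m = int k" by (rule nonneg_int_cases)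
  then show ?thesis unfolding card_dm_set by (simp only: N_S_spt_gf dm_set_dm_gf_pos dm_gf_pos_eq_spt_gf)
next
  case False
  then obtain k where "m = - int k" by (metis nonpos_int_cases linear)
  then show ?thesis
    unfolding card_dm_set by (simp only: N_S_uminus N_S_spt_gf dm_set_dm_gf_neg dm_gf_neg_eq_spt_gf)
qed

end
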